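(* For any integer $d\ge2$, there exist a finitely generated subgroup $K_d$ of R. Thompson's group $F$, finite generating sets $X$ of $K_d$ and $Y$ of $F$, and a positive integer constant $C$ such that the corresponding distortion function of $K_d$ in $F$ satisfies $$n^d\le C\,\mathrm{disto}(n)\qquad\text{for all positive integers } n,$$ that is, $n^d\preceq\mathrm{disto}(n)$.
   Context: R. Thompson's group $F$ is the group, under composition, of all increasing continuous piecewise linear maps of $[0,1]$ onto itself whose singularities occur at finitely many dyadic points (points of the form $m/2^n$) and all of whose slopes are integer powers of $2$; it is finitely generated. For a group with finite generating set $X$, $|g|_X$ denotes the word length of $g$ with respect to $X$. If $A\le B$ are finitely generated groups with finite generating sets $X$ of $A$ and $Y$ of $B$, the distortion function of $A$ in $B$ is $\mathrm{disto}(n)=\max\{|g|_X : g\in A,\ |g|_Y\le n\}$. For functions with nonnegative integer values, $\phi\preceq\psi$ means that there is a positive integer constant $C$ with $\phi\le C\psi$ everywhere. *)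

theory Defs
  imports Complex_Main "HOL-Algebra.Bij" "HOL-Algebra.Generated_Groups"
begin

definition dyadic :: "real \<Rightarrow> bool"
  where "dyadic x \<longleftrightarrow> (\<exists>(m::int) (n::nat). x = real_of_int m / 2 ^ n)"

text \<open>
  Outside the finite set \<open>P\<close> of dyadic points (in particular, between any two
  consecutive points of \<open>P\<close>) the map is affine with slope an integer power of \<open>2\<close>.
\<close>

definition dyadic_piecewise_linear :: "(real \<Rightarrow> real) \<Rightarrow> bool"
  where "dyadic_piecewise_linear f \<longleftrightarrow>
    (\<exists>P. finite P \<and> P \<subseteq> {0..1} \<and> (\<forall>x\<in>P. dyadic x) \<and>
      (\<forall>a b. 0 \<le> a \<and> a < b \<and> b \<le> 1 \<and> {a<..<b} \<inter> P = {} \<longrightarrow>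
        (\<exists>(k::int) (c::real). \<forall>x\<in>{a..b}. f x = 2 powi k * x + c)))"

text \<open>
  The elements of \<open>Bij {0..1}\<close> are extensional, i.e. \<open>undefined\<close> outside \<open>[0,1]\<close>, so
  each self-map of \<open>[0,1]\<close> is represented by exactly one function on the reals.
  The group operation of \<open>BijGroup\<close> is composition.
\<close>

definition thompson_F :: "(real \<Rightarrow> real) monoid"
  where "thompson_F = (BijGroup {0..1::real})
    \<lparr>carrier := {f \<in> Bij {0..1}. strict_mono_on {0..1} f \<and> continuous_on {0..1} f \<and>
                   dyadic_piecewise_linear f}\<rparr>"

text \<open>
  Letters are generators and their inverses. For a subgroup \<open>H\<close> of \<open>G\<close> and \<open>X \<subseteq> H\<close>,
  products and inverses of letters agree in \<open>H\<close> and \<open>G\<close>, so the word length in \<open>H\<close>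
  may be evaluated in the ambient group. It is meaningful for \<open>g \<in> generate G X\<close> only.
\<close>

definition word_length :: "('a, 'b) monoid_scheme \<Rightarrow> 'a set \<Rightarrow> 'a \<Rightarrow> nat"
  where "word_length G X g =
    (LEAST n. \<exists>ws. length ws = n \<and> set ws \<subseteq> X \<union> m_inv G ` X \<and>
                   foldr (mult G) ws \<one>\<^bsub>G\<^esub> = g)"

text \<open>
  Distortion of \<open>A\<close>, generated by \<open>X\<close>, in \<open>G\<close>, generated by \<open>Y\<close>. For a subgroup \<open>A\<close> of a
  group \<open>G\<close> and finite \<open>Y\<close>, the set below is finite (balls are finite) and contains
  \<open>word_length G X \<one>\<^bsub>G\<^esub>\<close>, so the maximum exists.
\<close>

definition distortion ::
  "('a, 'b) monoid_scheme \<Rightarrow> 'a set \<Rightarrow> 'a set \<Rightarrow> 'a set \<Rightarrow> nat \<Rightarrow> nat"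
  where "distortion G A X Y n =
    Max {word_length G X g |g. g \<in> A \<and> word_length G Y g \<le> n}"

end

theory Submission
  imports Defs
begin

text \<open>
  Let \<open>t = x0\<close> be the standard generator of \<open>F\<close> moving every point of \<open>(0,1)\<close> to the right, and let
  \<open>a = bump\<close> be supported in the fundamental domain \<open>[1/2, 3/4]\<close> of \<open>t\<close>. The conjugates of \<open>a\<close> by
  powers of \<open>t\<close> have disjoint supports, so \<open>t\<close> and \<open>a\<close> generate a wreath product of two infinite
  cyclic groups. Its base group is written additively as the module of Laurent polynomials in \<open>t\<close>,
  generated by \<open>a\<close>; the commutator \<open>x (t^n x t^-n)^-1\<close>, called \<open>conj_diff\<close> below, is then
  multiplication of \<open>x\<close> by \<open>1 - t^n\<close>.

  Let \<open>K\<close> be generated by \<open>t\<close> and \<open>b = (1 - t)^d a\<close>. The witnesses for the distortion are the elements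
  \<open>h_n = (1 - t^n)^d a = (1 + t + ... + t^(n-1))^d b\<close>, which lie in \<open>K\<close> by the second expression.

  \<^item> In \<open>F\<close> they are short: each of the \<open>d\<close> commutators at most doubles the length and adds \<open>2n\<close>, so the
    length of \<open>h_n\<close> is linear in \<open>n\<close> (\<open>word_length_conj_diff_funpow\<close>).

  \<^item> In \<open>K\<close> they are long: a word for \<open>h_n\<close> writes it as \<open>f b\<close>, where the letters \<open>b\<close> and their inverses
    contribute one monomial with sign each. Hence there are at least \<open>f(1) = n^d\<close> of them. The number
    \<open>f(1)\<close> is read off from \<open>h_n\<close> alone by pairing its exponent function with a binomial polynomial of
    degree \<open>d\<close>, whose \<open>d\<close>-th difference is \<open>1\<close> (\<open>pairing_diff_op_gbinomial\<close>, \<open>word_acts\<close>). The exponent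
    function itself is determined by the action on one orbit in \<open>[0,1]\<close>.

  The other half of the work is that \<open>F\<close> is finitely generated. Every element of \<open>F\<close> carries some
  subdivision of \<open>[0,1]\<close> into standard dyadic intervals affinely, piece by piece, onto another one
  (\<open>carrier_imp_carries\<close>). Powers of \<open>x0\<close> on both sides make the first piece equal to \<open>[0,1/2]\<close> in both
  subdivisions. The result lives on \<open>[1/2,1]\<close>, where it is the rescaled copy of an element with one
  piece less (\<open>generated_by_x0_rscale\<close>). Rescaling maps the group generated by \<open>x0\<close> and the rescaled
  \<open>x0\<close> into itself, because conjugation by \<open>x0\<close> moves one rescaled copy of \<open>F\<close> onto the next.
\<close>

section \<open>Words and distortion\<close>

context group
begin

lemma foldr_mult_closed: "set ws \<subseteq> carrier G \<Longrightarrow> foldr (\<otimes>) ws \<one> \<in> carrier G"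
  by (induction ws) auto

lemma foldr_mult_append:
  assumes "set ws \<subseteq> carrier G" "set vs \<subseteq> carrier G"
  shows "foldr (\<otimes>) (ws @ vs) \<one> = foldr (\<otimes>) ws \<one> \<otimes> foldr (\<otimes>) vs \<one>"
  using assms foldr_mult_closed[of vs]
  by (induction ws) (auto simp: m_assoc foldr_mult_closed)

lemma foldr_letters_append:
  assumes "X \<subseteq> carrier G" "set ws \<subseteq> X \<union> m_inv G ` X" "set vs \<subseteq> X \<union> m_inv G ` X"
  shows "foldr (\<otimes>) (ws @ vs) \<one> = foldr (\<otimes>) ws \<one> \<otimes> foldr (\<otimes>) vs \<one>"
proof -
  have "X \<union> m_inv G ` X \<subseteq> carrier G" using assms(1) by auto
  then show ?thesis using assms by (intro foldr_mult_append) blast+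
qed

lemma generate_imp_word:
  assumes X: "X \<subseteq> carrier G" and g: "g \<in> generate G X"
  shows "\<exists>ws. set ws \<subseteq> X \<union> m_inv G ` X \<and> foldr (\<otimes>) ws \<one> = g"
  using g
proof (induction rule: generate.induct)
  case one
  show ?case by (rule exI[of _ "[]"]) simp
next
  case (incl h)
  then show ?case using X by (intro exI[of _ "[h]"]) auto
next
  case (inv h)
  then show ?case using X by (intro exI[of _ "[inv h]"]) auto
next
  case (eng h1 h2)
  then obtain ws vs where "set ws \<subseteq> X \<union> m_inv G ` X" "foldr (\<otimes>) ws \<one> = h1"
    "set vs \<subseteq> X \<union> m_inv G ` X" "foldr (\<otimes>) vs \<one> = h2" by blast
  then show ?case
    by (intro exI[of _ "ws @ vs"]) (simp add: foldr_letters_append[OF X] del: foldr_append)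
qed

lemma word_length_le:
  assumes "set ws \<subseteq> X \<union> m_inv G ` X" "foldr (\<otimes>) ws \<one> = g"
  shows "word_length G X g \<le> length ws"
  unfolding word_length_def using assms by (intro Least_le) blast

lemma word_length_word:
  assumes "X \<subseteq> carrier G" "g \<in> generate G X"
  obtains ws where "length ws = word_length G X g" "set ws \<subseteq> X \<union> m_inv G ` X" "foldr (\<otimes>) ws \<one> = g"
proof -
  have "\<exists>n ws. length ws = n \<and> set ws \<subseteq> X \<union> m_inv G ` X \<and> foldr (\<otimes>) ws \<one> = g"
    using generate_imp_word[OF assms] by blast
  from LeastI_ex[OF this] show thesis using that unfolding word_length_def by blast
qed

lemma word_length_generator: "x \<in> X \<Longrightarrow> X \<subseteq> carrier G \<Longrightarrow> word_length G X x \<le> 1"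
  using word_length_le[of "[x]" X x] by auto

lemma word_length_one: "word_length G X \<one> = 0"
  using word_length_le[of "[]" X \<one>] by simp

lemma word_length_mult:
  assumes X: "X \<subseteq> carrier G" and g: "g \<in> generate G X" and h: "h \<in> generate G X"
  shows "word_length G X (g \<otimes> h) \<le> word_length G X g + word_length G X h"
proof -
  obtain ws where ws: "length ws = word_length G X g" "set ws \<subseteq> X \<union> m_inv G ` X" "foldr (\<otimes>) ws \<one> = g"
    using word_length_word[OF X g] .
  obtain vs where vs: "length vs = word_length G X h" "set vs \<subseteq> X \<union> m_inv G ` X" "foldr (\<otimes>) vs \<one> = h"
    using word_length_word[OF X h] .
  have "foldr (\<otimes>) (ws @ vs) \<one> = g \<otimes> h"
    using ws vs by (simp add: foldr_letters_append[OF X] del: foldr_append)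
  then have "word_length G X (g \<otimes> h) \<le> length (ws @ vs)"
    using ws vs by (intro word_length_le) auto
  then show ?thesis using ws vs by simp
qed

lemma word_length_inv:
  assumes X: "X \<subseteq> carrier G" and g: "g \<in> generate G X"
  shows "word_length G X (inv g) \<le> word_length G X g"
proof -
  obtain ws where ws: "length ws = word_length G X g" "set ws \<subseteq> X \<union> m_inv G ` X" "foldr (\<otimes>) ws \<one> = g"
    using word_length_word[OF X g] .
  have "X \<union> m_inv G ` X \<subseteq> carrier G" using X by auto
  then have "set ws \<subseteq> carrier G" using ws by blast
  then have "foldr (\<otimes>) (rev (map (m_inv G) ws)) \<one> = inv (foldr (\<otimes>) ws \<one>)"
  proof (induction ws)
    case (Cons w ws)
    then have "set (rev (map (m_inv G) ws)) \<subseteq> carrier G" by auto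
    then have "foldr (\<otimes>) (rev (map (m_inv G) ws) @ [inv w]) \<one>
        = foldr (\<otimes>) (rev (map (m_inv G) ws)) \<one> \<otimes> foldr (\<otimes>) [inv w] \<one>"
      using Cons.prems by (intro foldr_mult_append) auto
    then show ?case using Cons by (simp add: inv_mult_group foldr_mult_closed del: foldr_append)
  qed simp
  moreover have "set (rev (map (m_inv G) ws)) \<subseteq> X \<union> m_inv G ` X"
    using ws X by (force simp: subset_iff)
  ultimately show ?thesis using word_length_le[of "rev (map (m_inv G) ws)" X "inv g"] ws by simp
qed

lemma word_length_pow:
  assumes X: "X \<subseteq> carrier G" and x: "x \<in> X"
  shows "word_length G X (x [^] (n::nat)) \<le> n"
proof (induction n)
  case 0 then show ?case by (simp add: word_length_one)
next
  case (Suc n)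
  interpret H: subgroup "generate G X" G by (rule generate_is_subgroup[OF X])
  have xg: "x \<in> generate G X" using x by (rule generate.incl)
  then have "x [^] n \<in> generate G X" by (induction n) auto
  then have "word_length G X (x [^] n \<otimes> x) \<le> word_length G X (x [^] n) + word_length G X x"
    using word_length_mult[OF X] xg by blast
  then show ?case using Suc word_length_generator[OF x X] by simp
qed

text \<open>
  The ball of radius \<open>n\<close> is finite when \<open>Y\<close> is, so the maximum in the definition of distortion is
  attained and bounds each of its members.
\<close>

lemma word_length_le_distortion:
  assumes Y: "finite Y" "Y \<subseteq> carrier G" "generate G Y = carrier G"
    and A: "A \<subseteq> carrier G" and g: "g \<in> A" "word_length G Y g \<le> n"
  shows "word_length G X g \<le> distortion G A X Y n"
proof -
  let ?L = "{ws. set ws \<subseteq> Y \<union> m_inv G ` Y \<and> length ws \<le> n}"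
  have "{g. g \<in> A \<and> word_length G Y g \<le> n} \<subseteq> (\<lambda>ws. foldr (\<otimes>) ws \<one>) ` ?L"
  proof
    fix h assume h: "h \<in> {g. g \<in> A \<and> word_length G Y g \<le> n}"
    then have "h \<in> generate G Y" using A Y by auto
    then obtain ws where "length ws = word_length G Y h" "set ws \<subseteq> Y \<union> m_inv G ` Y"
      "foldr (\<otimes>) ws \<one> = h" by (rule word_length_word[OF Y(2)])
    then show "h \<in> (\<lambda>ws. foldr (\<otimes>) ws \<one>) ` ?L" using h by auto
  qed
  moreover have "finite ?L" using Y(1) by (intro finite_lists_length_le) auto
  ultimately have "finite {g. g \<in> A \<and> word_length G Y g \<le> n}" by (meson finite_imageI finite_subset)
  then have "finite {word_length G X g |g. g \<in> A \<and> word_length G Y g \<le> n}" by simp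
  then show ?thesis unfolding distortion_def using g by (intro Max_ge) auto
qed

end

section \<open>Iterated commutators\<close>

text \<open>
  This is multiplication by \<open>1 - t^n\<close> if \<open>x\<close> lies in an abelian subgroup on which \<open>t\<close> acts by
  conjugation, written additively.
\<close>

definition conj_diff :: "('a, 'b) monoid_scheme \<Rightarrow> 'a \<Rightarrow> nat \<Rightarrow> 'a \<Rightarrow> 'a"
  where "conj_diff G t n x =
    x \<otimes>\<^bsub>G\<^esub> inv\<^bsub>G\<^esub> (t [^]\<^bsub>G\<^esub> n \<otimes>\<^bsub>G\<^esub> x \<otimes>\<^bsub>G\<^esub> inv\<^bsub>G\<^esub> (t [^]\<^bsub>G\<^esub> n))"

context group
begin

lemma conj_mult:
  assumes "s \<in> carrier G" "x \<in> carrier G" "y \<in> carrier G"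
  shows "s \<otimes> (x \<otimes> y) \<otimes> inv s = (s \<otimes> x \<otimes> inv s) \<otimes> (s \<otimes> y \<otimes> inv s)"
  using assms by (simp add: m_assoc inv_solve_left)

lemma conj_inv:
  assumes "s \<in> carrier G" "x \<in> carrier G"
  shows "s \<otimes> inv x \<otimes> inv s = inv (s \<otimes> x \<otimes> inv s)"
  using assms by (simp add: m_assoc inv_mult_group)

lemma conj_conj:
  assumes "s \<in> carrier G" "r \<in> carrier G" "x \<in> carrier G"
  shows "s \<otimes> (r \<otimes> x \<otimes> inv r) \<otimes> inv s = (s \<otimes> r) \<otimes> x \<otimes> inv (s \<otimes> r)"
  using assms by (simp add: m_assoc inv_mult_group)

lemma mult_cancel_middle:
  assumes "x \<in> carrier G" "u \<in> carrier G" "v \<in> carrier G"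
  shows "(x \<otimes> inv u) \<otimes> (u \<otimes> v) = x \<otimes> v"
  using assms by (metis inv_closed l_inv l_one m_assoc m_closed)

lemma conj_diff_closed [simp]:
  "t \<in> carrier G \<Longrightarrow> x \<in> carrier G \<Longrightarrow> conj_diff G t n x \<in> carrier G"
  by (simp add: conj_diff_def)

text \<open>
  The identity behind this is \<open>1 - t^(n+1) = (1 - t^n) + t^n (1 - t)\<close>. As a product of group elements it
  telescopes without any commutativity.
\<close>

lemma conj_diff_in_subgroup:
  assumes K: "subgroup K G" and t: "t \<in> K" and x: "x \<in> carrier G" and D: "conj_diff G t 1 x \<in> K"
  shows "conj_diff G t n x \<in> K"
proof (induction n)
  interpret K: subgroup K G by (rule K)
  case 0
  then show ?case using x by (simp add: conj_diff_def)
next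
  interpret K: subgroup K G by (rule K)
  case (Suc n)
  have tc: "t \<in> carrier G" using t by simp
  let ?s = "t [^] n"
  have s: "?s \<in> carrier G" using tc by simp
  have "?s \<in> K" using t by (induction n) auto
  have "?s \<otimes> conj_diff G t 1 x \<otimes> inv ?s
      = (?s \<otimes> x \<otimes> inv ?s) \<otimes> inv (t [^] Suc n \<otimes> x \<otimes> inv (t [^] Suc n))"
  proof -
    have "conj_diff G t 1 x = x \<otimes> inv (t \<otimes> x \<otimes> inv t)" using tc by (simp add: conj_diff_def)
    moreover have "t \<otimes> x \<otimes> inv t \<in> carrier G" using tc x by simp
    ultimately show ?thesis
      using conj_mult[of ?s x "inv (t \<otimes> x \<otimes> inv t)"] conj_inv[of ?s "t \<otimes> x \<otimes> inv t"]
        conj_conj[of ?s t x] tc x s by (simp only: nat_pow_Suc inv_closed)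
  qed
  then have "conj_diff G t (Suc n) x = conj_diff G t n x \<otimes> (?s \<otimes> conj_diff G t 1 x \<otimes> inv ?s)"
    using tc x s mult_cancel_middle[of x "?s \<otimes> x \<otimes> inv ?s" "inv (t [^] Suc n \<otimes> x \<otimes> inv (t [^] Suc n))"]
    by (simp only: conj_diff_def nat_pow_closed inv_closed m_closed)
  then show ?case using Suc D \<open>?s \<in> K\<close> by simp
qed

lemma generate_commute:
  assumes S: "S \<subseteq> carrier G" and c: "\<And>x y. x \<in> S \<Longrightarrow> y \<in> S \<Longrightarrow> x \<otimes> y = y \<otimes> x"
    and x: "x \<in> generate G S" and y: "y \<in> generate G S"
  shows "x \<otimes> y = y \<otimes> x"
proof -
  have *: "z \<otimes> w = w \<otimes> z"
    if z: "z \<in> carrier G" and zS: "\<And>s. s \<in> S \<Longrightarrow> z \<otimes> s = s \<otimes> z" and w: "w \<in> generate G S" for z w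
    using w
  proof (induction rule: generate.induct)
    case one then show ?case using z by simp
  next
    case (incl h) then show ?case using zS by simp
  next
    case (inv h)
    then have "h \<in> carrier G" using S by blast
    then show ?case using zS[OF inv] z by (metis inv_closed inv_solve_left inv_solve_right m_assoc m_closed)
  next
    case (eng h1 h2)
    then have "h1 \<in> carrier G" "h2 \<in> carrier G" using generate_in_carrier[OF S] by auto
    then show ?case using eng z by (metis m_assoc)
  qed
  have "x \<otimes> s = s \<otimes> x" if "s \<in> S" for s
    using *[of s x] that S c x by force
  then show ?thesis using *[of x y] generate_in_carrier[OF S x] y by blast
qed

end

text \<open>
  The subgroup \<open>N\<close> is a module over the Laurent polynomials in \<open>t\<close>, and the operators
  \<open>conj_diff G t n\<close> on it are multiplications by commuting ring elements.
\<close>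

locale abelian_shift = group +
  fixes N t
  assumes N: "subgroup N G" and t [simp]: "t \<in> carrier G"
    and N_comm: "\<And>x y. x \<in> N \<Longrightarrow> y \<in> N \<Longrightarrow> x \<otimes> y = y \<otimes> x"
    and N_conj: "\<And>x. x \<in> N \<Longrightarrow> t \<otimes> x \<otimes> inv t \<in> N"
begin

sublocale N: subgroup N G by (rule N)

lemma N_conj_pow: "x \<in> N \<Longrightarrow> t [^] (n::nat) \<otimes> x \<otimes> inv (t [^] n) \<in> N"
proof (induction n arbitrary: x)
  case 0 then show ?case by simp
next
  case (Suc n)
  have "t [^] Suc n \<otimes> x \<otimes> inv (t [^] Suc n) = t [^] n \<otimes> (t \<otimes> x \<otimes> inv t) \<otimes> inv (t [^] n)"
    using Suc.prems by (simp add: conj_conj)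
  then show ?case using Suc N_conj by simp
qed

lemma conj_diff_N: "x \<in> N \<Longrightarrow> conj_diff G t n x \<in> N"
  unfolding conj_diff_def using N_conj_pow by simp

lemma conj_diff_mult:
  assumes x: "x \<in> N" and y: "y \<in> N"
  shows "conj_diff G t n (x \<otimes> y) = conj_diff G t n x \<otimes> conj_diff G t n y"
proof -
  let ?c = "\<lambda>x. t [^] n \<otimes> x \<otimes> inv (t [^] n)"
  have N': "?c x \<in> N" "?c y \<in> N" using N_conj_pow x y by auto
  have "conj_diff G t n (x \<otimes> y) = x \<otimes> y \<otimes> inv (?c x \<otimes> ?c y)"
    using x y by (simp add: conj_diff_def conj_mult)
  also have "\<dots> = x \<otimes> (y \<otimes> (inv (?c y) \<otimes> inv (?c x)))"
    using x y N'[THEN N.mem_carrier]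
    by (simp only: inv_mult_group m_assoc m_closed inv_closed N.mem_carrier)
  also have "\<dots> = x \<otimes> (inv (?c x) \<otimes> (y \<otimes> inv (?c y)))"
    using N_comm[of "y \<otimes> inv (?c y)" "inv (?c x)"] x y N'
    by (simp only: m_assoc[symmetric] N.m_closed N.m_inv_closed N.mem_carrier inv_closed)
  also have "\<dots> = conj_diff G t n x \<otimes> conj_diff G t n y"
    using x y N'[THEN N.mem_carrier]
    by (simp only: conj_diff_def m_assoc m_closed inv_closed N.mem_carrier)
  finally show ?thesis .
qed

lemma conj_diff_commute:
  assumes x: "x \<in> N"
  shows "conj_diff G t m (conj_diff G t n x) = conj_diff G t n (conj_diff G t m x)"
proof -
  let ?c = "\<lambda>x. t [^] n \<otimes> x \<otimes> inv (t [^] n)"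
  have inv: "conj_diff G t m (inv y) = inv (conj_diff G t m y)" if y: "y \<in> N" for y
  proof -
    have "conj_diff G t m (inv y) \<otimes> conj_diff G t m y = conj_diff G t m \<one>"
      using conj_diff_mult[of "inv y" y m] y by simp
    also have "\<dots> = \<one>" by (simp add: conj_diff_def)
    finally show ?thesis using y by (metis inv_equality conj_diff_closed t N.mem_carrier N.m_inv_closed)
  qed
  have c: "conj_diff G t m (?c x) = ?c (conj_diff G t m x)"
  proof -
    have "t [^] m \<otimes> t [^] n = t [^] n \<otimes> t [^] m" by (simp add: nat_pow_mult add.commute)
    moreover have "conj_diff G t m (?c x) = ?c x \<otimes> inv ((t [^] m \<otimes> t [^] n) \<otimes> x \<otimes> inv (t [^] m \<otimes> t [^] n))"
      using conj_conj[of "t [^] m" "t [^] n" x] x by (simp only: conj_diff_def nat_pow_closed t N.mem_carrier)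
    moreover have "?c (conj_diff G t m x) = ?c x \<otimes> inv ((t [^] n \<otimes> t [^] m) \<otimes> x \<otimes> inv (t [^] n \<otimes> t [^] m))"
      using conj_mult[of "t [^] n" x "inv (t [^] m \<otimes> x \<otimes> inv (t [^] m))"]
        conj_inv[of "t [^] n" "t [^] m \<otimes> x \<otimes> inv (t [^] m)"] conj_conj[of "t [^] n" "t [^] m" x] x
      by (simp only: conj_diff_def nat_pow_closed t N.mem_carrier m_closed inv_closed)
    ultimately show ?thesis by simp
  qed
  have "conj_diff G t m (conj_diff G t n x) = conj_diff G t m (x \<otimes> inv (?c x))"
    by (simp add: conj_diff_def)
  also have "\<dots> = conj_diff G t m x \<otimes> inv (?c (conj_diff G t m x))"
    using N_conj_pow[OF x] x by (subst conj_diff_mult) (auto simp: inv c)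
  also have "\<dots> = conj_diff G t n (conj_diff G t m x)" by (simp add: conj_diff_def)
  finally show ?thesis .
qed

lemma conj_diff_funpow_N: "x \<in> N \<Longrightarrow> (conj_diff G t n ^^ m) x \<in> N"
  by (induction m) (auto intro: conj_diff_N)

lemma conj_diff_funpow_commute:
  "x \<in> N \<Longrightarrow> (conj_diff G t k ^^ m) (conj_diff G t n x) = conj_diff G t n ((conj_diff G t k ^^ m) x)"
  by (induction m) (simp_all add: conj_diff_commute conj_diff_funpow_N)

text \<open>
  Here \<open>(1 - t^n)^m x\<close> is recognised as a multiple of \<open>(1 - t)^m x\<close>. One factor is exchanged at a time:
  \<open>(1 - t^n)^m\<close> applied to \<open>(1 - t^n) x\<close> is a multiple of \<open>(1 - t)^m (1 - t^n) x\<close>, which after commuting the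
  operators is a multiple of \<open>(1 - t)^(m+1) x\<close>.
\<close>

lemma conj_diff_funpow_generate:
  "x \<in> N \<Longrightarrow> (conj_diff G t n ^^ m) x \<in> generate G {t, (conj_diff G t 1 ^^ m) x}"
proof (induction m arbitrary: x)
  case 0 then show ?case by (simp add: generate.incl)
next
  case (Suc m)
  let ?y = "(conj_diff G t 1 ^^ m) x"
  let ?K = "generate G {t, (conj_diff G t 1 ^^ Suc m) x}"
  have y: "?y \<in> carrier G" using conj_diff_funpow_N[OF Suc.prems] by simp
  then have sub: "subgroup ?K G" by (intro generate_is_subgroup) auto
  have "t \<in> ?K" by (auto intro: generate.incl)
  moreover have "conj_diff G t 1 ?y \<in> ?K" by (auto intro: generate.incl)
  ultimately have "conj_diff G t n ?y \<in> ?K" using conj_diff_in_subgroup[OF sub _ y] by blast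
  then have "generate G {t, conj_diff G t n ?y} \<subseteq> ?K"
    using \<open>t \<in> ?K\<close> sub by (intro generate_subgroup_incl) auto
  moreover have "(conj_diff G t n ^^ m) (conj_diff G t n x) \<in> generate G {t, conj_diff G t n ?y}"
    using Suc.IH[OF conj_diff_N[OF Suc.prems], of n] conj_diff_funpow_commute[OF Suc.prems] by simp
  ultimately have "(conj_diff G t n ^^ m) (conj_diff G t n x) \<in> ?K" by blast
  then show ?case by (simp only: funpow_Suc_right comp_apply)
qed

end

lemma (in group) word_length_conj_diff:
  assumes Y: "Y \<subseteq> carrier G" and t: "t \<in> Y" and x: "x \<in> generate G Y"
  shows "word_length G Y (conj_diff G t n x) \<le> 2 * word_length G Y x + 2 * n"
proof -
  interpret H: subgroup "generate G Y" G by (rule generate_is_subgroup[OF Y])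
  let ?s = "t [^] n" and ?l = "word_length G Y"
  have "t \<in> generate G Y" using t by (rule generate.incl)
  then have s: "?s \<in> generate G Y" by (induction n) auto
  note m = word_length_mult[OF Y] and i = word_length_inv[OF Y]
  have "?l (conj_diff G t n x) \<le> ?l x + ?l (?s \<otimes> x \<otimes> inv ?s)"
    unfolding conj_diff_def
    using m[of x "inv (?s \<otimes> x \<otimes> inv ?s)"] i[of "?s \<otimes> x \<otimes> inv ?s"] s x by force
  moreover have "?l (?s \<otimes> x \<otimes> inv ?s) \<le> ?l ?s + ?l x + ?l ?s"
    using m[of "?s \<otimes> x" "inv ?s"] m[of ?s x] i[of ?s] s x by force
  ultimately show ?thesis using word_length_pow[OF Y t, of n] by simp
qed

lemma (in group) word_length_conj_diff_funpow:
  assumes Y: "Y \<subseteq> carrier G" and t: "t \<in> Y" and x: "x \<in> Y"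
  shows "word_length G Y ((conj_diff G t n ^^ m) x) \<le> 2 ^ m * (2 * n + 1)"
proof -
  interpret H: subgroup "generate G Y" G by (rule generate_is_subgroup[OF Y])
  have "t \<in> generate G Y" using t by (rule generate.incl)
  then have s: "t [^] k \<in> generate G Y" for k :: nat by (induction k) auto
  \<comment> \<open>The bound is strengthened by \<open>2 * n\<close>, which makes it stable under \<open>l \<mapsto> 2 * l + 2 * n\<close>.\<close>
  have "(conj_diff G t n ^^ m) x \<in> generate G Y \<and>
      word_length G Y ((conj_diff G t n ^^ m) x) + 2 * n \<le> 2 ^ m * (2 * n + 1)"
  proof (induction m)
    case 0
    then show ?case using word_length_generator[OF x Y] x by (simp add: generate.incl)
  next
    case (Suc m)
    let ?y = "(conj_diff G t n ^^ m) x"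
    have "?y \<in> generate G Y" using Suc by blast
    then have "conj_diff G t n ?y \<in> generate G Y"
      unfolding conj_diff_def using s[of n] by (intro H.m_closed H.m_inv_closed)
    moreover have "word_length G Y (conj_diff G t n ?y) \<le> 2 * word_length G Y ?y + 2 * n"
      using word_length_conj_diff[OF Y t] Suc by blast
    ultimately show ?case using Suc by simp
  qed
  then show ?thesis by simp
qed

section \<open>The group F\<close>

lemma dyadic_zero: "dyadic 0"
  unfolding dyadic_def by (rule exI[of _ 0]) simp

lemma dyadic_add:
  assumes "dyadic x" "dyadic y"
  shows "dyadic (x + y)"
proof -
  obtain a m where x: "x = real_of_int a / 2 ^ m" using assms(1) unfolding dyadic_def by blast
  obtain b n where y: "y = real_of_int b / 2 ^ n" using assms(2) unfolding dyadic_def by blast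
  have "x + y = real_of_int (a * 2 ^ n + b * 2 ^ m) / 2 ^ (m + n)"
    unfolding x y by (simp add: field_simps power_add)
  then show ?thesis unfolding dyadic_def by blast
qed

lemma dyadic_minus: "dyadic x \<Longrightarrow> dyadic (- x)"
  unfolding dyadic_def by (metis minus_divide_left of_int_minus)

lemma dyadic_diff: "dyadic x \<Longrightarrow> dyadic y \<Longrightarrow> dyadic (x - y)"
  using dyadic_add[of x "- y"] dyadic_minus[of y] by simp

lemma dyadic_powi_mult:
  assumes "dyadic x"
  shows "dyadic (2 powi k * x)"
proof -
  obtain a m where x: "x = real_of_int a / 2 ^ m" using assms(1) unfolding dyadic_def by blast
  show ?thesis
  proof (cases "k \<ge> 0")
    case True
    then have "2 powi k * x = real_of_int (a * 2 ^ nat k) / 2 ^ m"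
      unfolding x by (simp add: power_int_def)
    then show ?thesis unfolding dyadic_def by blast
  next
    case False
    then have "2 powi k * x = real_of_int a / 2 ^ (m + nat (- k))"
      unfolding x by (simp add: power_int_def power_add power_one_over inverse_eq_divide)
    then show ?thesis unfolding dyadic_def by blast
  qed
qed

text \<open>
  Induction on the number of breakpoints before \<open>x\<close>: between the last of them and \<open>x\<close> the map is affine
  with slope a power of \<open>2\<close>, so it increases by a dyadic amount. This needs the value \<open>0\<close> at \<open>0\<close> to start.
\<close>

lemma dyadic_image:
  assumes f: "dyadic_piecewise_linear f" and f0: "f 0 = 0"
    and x: "x \<in> {0..1}" "dyadic x"
  shows "dyadic (f x)"
proof -
  from f obtain P where P: "finite P" "\<And>x. x \<in> P \<Longrightarrow> dyadic x" "P \<subseteq> {0..1}"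
    and lin: "\<And>a b. 0 \<le> a \<Longrightarrow> a < b \<Longrightarrow> b \<le> 1 \<Longrightarrow> {a<..<b} \<inter> P = {} \<Longrightarrow>
        (\<exists>(k::int) (c::real). \<forall>x\<in>{a..b}. f x = 2 powi k * x + c)"
    unfolding dyadic_piecewise_linear_def by metis
  show ?thesis using x
  proof (induction "card (P \<inter> {0<..<x})" arbitrary: x rule: less_induct)
    case less
    show ?case
    proof (cases "x = 0")
      case True then show ?thesis using f0 dyadic_zero by simp
    next
      case False
      with less.prems have x0: "0 < x" by auto
      define y where "y = Max (insert 0 (P \<inter> {0<..<x}))"
      have y_in: "y \<in> insert 0 (P \<inter> {0<..<x})"
        unfolding y_def using P(1) by (intro Max_in) auto
      have y_ge: "z \<le> y" if "z \<in> P \<inter> {0<..<x}" for z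
        unfolding y_def using P(1) that by (intro Max_ge) auto
      have y: "0 \<le> y" "y < x" "y \<le> 1" using y_in x0 less.prems by auto
      have "dyadic (f y)"
      proof (cases "y = 0")
        case True then show ?thesis using f0 dyadic_zero by simp
      next
        case False
        have "P \<inter> {0<..<y} \<subset> P \<inter> {0<..<x}" using False y y_in by auto
        then have "card (P \<inter> {0<..<y}) < card (P \<inter> {0<..<x})"
          using P(1) by (intro psubset_card_mono) auto
        moreover have "dyadic y" using False y_in P(2) by auto
        ultimately show ?thesis using less.hyps[of y] y by auto
      qed
      moreover have "{y<..<x} \<inter> P = {}" using y_ge y by force
      then obtain k c where kc: "\<forall>z\<in>{y..x}. f z = 2 powi k * z + c"
        using lin[of y x] y less.prems by auto
      have "f x = f y + 2 powi k * (x - y)"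
        using kc y by (simp add: algebra_simps)
      moreover have "dyadic y" using y_in P(2) dyadic_zero by auto
      ultimately show ?thesis
        using dyadic_add dyadic_powi_mult dyadic_diff less.prems by metis
    qed
  qed
qed

lemma thompson_F_carrier_iff:
  "f \<in> carrier thompson_F \<longleftrightarrow> f \<in> Bij {0..1} \<and> strict_mono_on {0..1} f \<and>
    continuous_on {0..1} f \<and> dyadic_piecewise_linear f"
  unfolding thompson_F_def by simp

lemma thompson_F_endpoints:
  assumes "bij_betw f {0..1::real} {0..1}" "strict_mono_on {0..1} f"
  shows "f 0 = 0" "f 1 = (1::real)"
proof -
  have img: "f ` {0..1} = {0..1}" using assms(1) by (simp add: bij_betw_def)
  have "0 \<in> f ` {0..1}" "1 \<in> f ` {0..1}" unfolding img by simp_all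
  then obtain u v where "u \<in> {0..1}" "f u = 0" "v \<in> {0..1}" "f v = 1" by (auto simp: image_iff)
  moreover have "f 0 \<in> f ` {0..1}" "f 1 \<in> f ` {0..1}" by simp_all
  then have "f 0 \<in> {0..1}" "f 1 \<in> {0..1}" unfolding img .
  ultimately show "f 0 = 0" "f 1 = 1"
    using strict_mono_onD[OF assms(2), of 0 u] strict_mono_onD[OF assms(2), of v 1]
    by force+
qed

text \<open>
  The breakpoints of the inverse are the images of the breakpoints, which are dyadic by
  \<open>dyadic_image\<close>. Continuity comes from compactness of \<open>[0,1]\<close>.
\<close>

lemma carrier_inv_into:
  assumes f: "f \<in> carrier thompson_F"
  shows "restrict (inv_into {0..1} f) {0..1} \<in> carrier thompson_F"
proof -
  let ?I = "{0..1::real}"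
  let ?g = "restrict (inv_into {0..1} f) {0..1}"
  have bij: "bij_betw f ?I ?I" and mono: "strict_mono_on ?I f" and cont: "continuous_on ?I f"
    and pl: "dyadic_piecewise_linear f" and Bij: "f \<in> Bij ?I"
    using f unfolding thompson_F_carrier_iff Bij_def by auto
  have img: "f ` ?I = ?I" and inj: "inj_on f ?I" using bij by (auto simp: bij_betw_def)
  have gf: "?g (f x) = x" if "x \<in> ?I" for x
  proof -
    have "f x \<in> ?I" using that img by blast
    then show ?thesis using that inj by simp
  qed
  have fg: "f (?g y) = y" and gI: "?g y \<in> ?I" if "y \<in> ?I" for y
    using that f_inv_into_f[of y f ?I] inv_into_into[of y f ?I] unfolding img by simp_all
  have "?g \<in> Bij ?I" using restrict_inv_into_Bij[OF Bij] .
  moreover have gmono: "strict_mono_on ?I ?g"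
  proof (rule strict_mono_onI)
    fix r s :: real assume rs: "r \<in> ?I" "s \<in> ?I" "r < s"
    show "?g r < ?g s"
    proof (rule ccontr)
      assume "\<not> ?g r < ?g s"
      then have "f (?g s) \<le> f (?g r)"
        using mono gI rs by (metis less_eq_real_def not_less strict_mono_onD)
      then show False using fg[OF rs(1)] fg[OF rs(2)] rs by linarith
    qed
  qed
  moreover have "continuous_on ?I ?g"
  proof -
    have "continuous_on (f ` ?I) ?g"
      using cont gf by (intro continuous_on_inv) auto
    then show ?thesis unfolding img .
  qed
  moreover have "dyadic_piecewise_linear ?g"
  proof -
    from pl obtain P where P: "finite P" "\<And>x. x \<in> P \<Longrightarrow> dyadic x" "P \<subseteq> ?I"
      and lin: "\<And>a b. 0 \<le> a \<Longrightarrow> a < b \<Longrightarrow> b \<le> 1 \<Longrightarrow> {a<..<b} \<inter> P = {} \<Longrightarrow>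
        (\<exists>(k::int) (c::real). \<forall>x\<in>{a..b}. f x = 2 powi k * x + c)"
      unfolding dyadic_piecewise_linear_def by metis
    have f0: "f 0 = 0" using thompson_F_endpoints[OF bij mono] by simp
    have "\<exists>k c. \<forall>x\<in>{a..b}. ?g x = 2 powi k * x + c"
      if ab: "0 \<le> a" "a < b" "b \<le> 1" "{a<..<b} \<inter> f ` P = {}" for a b
    proof -
      have aI: "a \<in> ?I" and bI: "b \<in> ?I" using ab by auto
      have "x \<notin> P" if x: "x \<in> {?g a<..<?g b}" for x
      proof
        assume "x \<in> P"
        then have xI: "x \<in> ?I" using P by auto
        have "a < f x" "f x < b"
          using strict_mono_onD[OF mono gI[OF aI] xI] strict_mono_onD[OF mono xI gI[OF bI]]
            x fg[OF aI] fg[OF bI] by auto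
        then show False using ab \<open>x \<in> P\<close> by auto
      qed
      then have "{?g a<..<?g b} \<inter> P = {}" by auto
      moreover have "0 \<le> ?g a" "?g a < ?g b" "?g b \<le> 1"
        using strict_mono_onD[OF gmono aI bI ab(2)] gI[OF aI] gI[OF bI] by auto
      ultimately obtain k c where kc: "\<forall>x\<in>{?g a..?g b}. f x = 2 powi k * x + c"
        using lin by blast
      have "?g y = 2 powi (- k) * y + - (2 powi (- k) * c)" if y: "y \<in> {a..b}" for y
      proof -
        have yI: "y \<in> ?I" using y ab by auto
        have "?g a \<le> ?g y" "?g y \<le> ?g b"
          using strict_mono_onD[OF gmono aI yI] strict_mono_onD[OF gmono yI bI] y
          by (cases "a = y"; cases "y = b"; force)+
        then have "y = 2 powi k * ?g y + c" using kc fg[OF yI] by auto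
        then show ?thesis by (simp add: power_int_minus field_simps)
      qed
      then show ?thesis by blast
    qed
    moreover have "finite (f ` P)" "f ` P \<subseteq> ?I" using P img by auto
    moreover have "\<forall>x\<in>f ` P. dyadic x"
      using P dyadic_image[OF pl f0] by blast
    ultimately show ?thesis unfolding dyadic_piecewise_linear_def
      by (intro exI[of _ "f ` P"] conjI allI impI) simp_all
  qed
  ultimately show ?thesis unfolding thompson_F_carrier_iff by blast
qed

text \<open>
  A composition breaks at the breakpoints of the inner map and at the preimages of those of the outer
  map; the latter are dyadic since the inverse of the inner map also preserves dyadic points.
\<close>

lemma carrier_compose:
  assumes f: "f \<in> carrier thompson_F" and g: "g \<in> carrier thompson_F"
  shows "compose {0..1} g f \<in> carrier thompson_F"
proof -
  let ?I = "{0..1::real}"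
  let ?h = "compose {0..1} g f"
  have f': "bij_betw f ?I ?I" "strict_mono_on ?I f" "continuous_on ?I f"
     "dyadic_piecewise_linear f" "f \<in> Bij ?I"
    using f unfolding thompson_F_carrier_iff Bij_def by auto
  have g': "bij_betw g ?I ?I" "strict_mono_on ?I g" "continuous_on ?I g"
     "dyadic_piecewise_linear g" "g \<in> Bij ?I"
    using g unfolding thompson_F_carrier_iff Bij_def by auto
  have fI: "f x \<in> ?I" if "x \<in> ?I" for x using that f'(1) by (meson bij_betwE)
  have h: "?h x = g (f x)" if "x \<in> ?I" for x using that by (simp add: compose_def)
  have "?h \<in> Bij ?I" using f' g' by (simp add: compose_Bij)
  moreover have "strict_mono_on ?I ?h"
    using h fI f'(2) g'(2) by (simp add: strict_mono_on_def)
  moreover have "continuous_on ?I ?h"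
  proof -
    have "continuous_on ?I (g \<circ> f)"
      using f' g' by (intro continuous_on_compose) (auto simp: bij_betw_def)
    then show ?thesis by (subst continuous_on_cong[OF refl, of _ _ "g \<circ> f"]) (simp_all add: h)
  qed
  moreover have "dyadic_piecewise_linear ?h"
  proof -
    from f'(4) obtain P where P: "finite P" "\<And>x. x \<in> P \<Longrightarrow> dyadic x" "P \<subseteq> ?I"
      and lin: "\<And>a b. 0 \<le> a \<Longrightarrow> a < b \<Longrightarrow> b \<le> 1 \<Longrightarrow> {a<..<b} \<inter> P = {} \<Longrightarrow>
        (\<exists>(k::int) (c::real). \<forall>x\<in>{a..b}. f x = 2 powi k * x + c)"
      unfolding dyadic_piecewise_linear_def by metis
    from g'(4) obtain Q where Q: "finite Q" "\<And>x. x \<in> Q \<Longrightarrow> dyadic x" "Q \<subseteq> ?I"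
      and lin': "\<And>a b. 0 \<le> a \<Longrightarrow> a < b \<Longrightarrow> b \<le> 1 \<Longrightarrow> {a<..<b} \<inter> Q = {} \<Longrightarrow>
        (\<exists>(k::int) (c::real). \<forall>x\<in>{a..b}. g x = 2 powi k * x + c)"
      unfolding dyadic_piecewise_linear_def by metis
    define R where "R = P \<union> restrict (inv_into ?I f) ?I ` Q"
    note inv = carrier_inv_into[OF f]
    then have inv': "bij_betw (restrict (inv_into ?I f) ?I) ?I ?I"
      "strict_mono_on ?I (restrict (inv_into ?I f) ?I)"
      "dyadic_piecewise_linear (restrict (inv_into ?I f) ?I)"
      unfolding thompson_F_carrier_iff Bij_def by auto
    have "finite R" "R \<subseteq> ?I"
      using P Q bij_betw_imp_surj_on[OF inv'(1)] unfolding R_def by (simp, blast)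
    moreover have "\<forall>x\<in>R. dyadic x"
      unfolding R_def using P Q dyadic_image[OF inv'(3) thompson_F_endpoints(1)[OF inv'(1,2)]] by blast
    moreover have "\<exists>k c. \<forall>x\<in>{a..b}. ?h x = 2 powi k * x + c"
      if ab: "0 \<le> a" "a < b" "b \<le> 1" "{a<..<b} \<inter> R = {}" for a b
    proof -
      have aI: "a \<in> ?I" and bI: "b \<in> ?I" using ab by auto
      obtain k c where kc: "\<forall>x\<in>{a..b}. f x = 2 powi k * x + c"
        using lin[of a b] ab unfolding R_def by blast
      have "y \<notin> Q" if y: "y \<in> {f a<..<f b}" for y
      proof
        assume "y \<in> Q"
        then have "y \<in> ?I" using Q by auto
        then obtain x where x: "x \<in> ?I" "f x = y" "restrict (inv_into ?I f) ?I y = x"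
          using f'(1) by (metis bij_betw_imp_surj_on f_inv_into_f inv_into_into restrict_apply')
        then have "x \<in> R"
          using imageI[OF \<open>y \<in> Q\<close>, of "restrict (inv_into ?I f) ?I"] unfolding R_def by simp
        moreover have "a < x" "x < b"
          using strict_mono_on_less[OF f'(2) aI x(1)] strict_mono_on_less[OF f'(2) x(1) bI] y x by auto
        ultimately show False using ab by auto
      qed
      then have "{f a<..<f b} \<inter> Q = {}" by auto
      moreover have "f a < f b" using strict_mono_onD[OF f'(2) aI bI ab(2)] .
      ultimately obtain l e where le: "\<forall>x\<in>{f a..f b}. g x = 2 powi l * x + e"
        using lin'[of "f a" "f b"] fI[OF aI] fI[OF bI] by auto
      have "?h x = 2 powi (k + l) * x + (2 powi l * c + e)" if x: "x \<in> {a..b}" for x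
      proof -
        have xI: "x \<in> ?I" using x ab by auto
        have "f x \<in> {f a..f b}"
          using strict_mono_on_leD[OF f'(2)] aI bI xI x by auto
        then have "?h x = 2 powi l * (2 powi k * x + c) + e"
          using h[OF xI] le kc x by simp
        then show ?thesis by (simp add: power_int_add algebra_simps)
      qed
      then show ?thesis by blast
    qed
    ultimately show ?thesis unfolding dyadic_piecewise_linear_def
      by (intro exI[of _ R] conjI allI impI) simp_all
  qed
  ultimately show ?thesis unfolding thompson_F_carrier_iff by blast
qed

lemma carrier_id: "(\<lambda>x\<in>{0..1}. x) \<in> carrier thompson_F"
proof -
  have "dyadic_piecewise_linear (\<lambda>x\<in>{0..1}. x)"
    unfolding dyadic_piecewise_linear_def
  proof (intro exI[of _ "{}"] conjI allI impI)
    fix a b :: real assume "0 \<le> a \<and> a < b \<and> b \<le> 1 \<and> {a<..<b} \<inter> {} = {}"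
    then have "\<forall>x\<in>{a..b}. (\<lambda>x\<in>{0..1}. x) x = 2 powi 0 * x + 0" by auto
    then show "\<exists>(k::int) (c::real). \<forall>x\<in>{a..b}. (\<lambda>x\<in>{0..1}. x) x = 2 powi k * x + c" by blast
  qed auto
  moreover have "continuous_on {0..1::real} (\<lambda>x\<in>{0..1}. x)"
    by (subst continuous_on_cong[OF refl, of _ _ "\<lambda>x. x"]) simp_all
  ultimately show ?thesis
    unfolding thompson_F_carrier_iff by (auto simp: id_Bij strict_mono_on_def)
qed

lemma inv_BijGroup: "f \<in> Bij S \<Longrightarrow> inv\<^bsub>BijGroup S\<^esub> f = restrict (inv_into S f) S"
proof -
  assume f: "f \<in> Bij S"
  interpret group "BijGroup S" by (rule group_BijGroup)
  show ?thesis
    by (rule inv_equality)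
      (use f restrict_inv_into_Bij[OF f] Bij_compose_restrict_eq[OF f] in \<open>auto simp: BijGroup_def\<close>)
qed

lemma subgroup_thompson_F: "subgroup (carrier thompson_F) (BijGroup {0..1})"
proof (rule group.subgroupI[OF group_BijGroup])
  show "carrier thompson_F \<subseteq> carrier (BijGroup {0..1})"
    by (auto simp: thompson_F_carrier_iff BijGroup_def)
  show "carrier thompson_F \<noteq> {}" using carrier_id by blast
next
  fix f assume "f \<in> carrier thompson_F"
  then show "inv\<^bsub>BijGroup {0..1}\<^esub> f \<in> carrier thompson_F"
    using carrier_inv_into by (simp add: inv_BijGroup thompson_F_carrier_iff)
next
  fix f g assume "f \<in> carrier thompson_F" "g \<in> carrier thompson_F"
  then show "f \<otimes>\<^bsub>BijGroup {0..1}\<^esub> g \<in> carrier thompson_F"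
    using carrier_compose by (simp add: BijGroup_def thompson_F_carrier_iff)
qed

lemma thompson_F_eq: "thompson_F = (BijGroup {0..1})\<lparr>carrier := carrier thompson_F\<rparr>"
  unfolding thompson_F_def by simp

lemma group_thompson_F: "group thompson_F"
  using subgroup.subgroup_is_group[OF subgroup_thompson_F group_BijGroup] thompson_F_eq by simp

interpretation F: group thompson_F by (rule group_thompson_F)

lemma F_mult_apply:
  assumes "f \<in> carrier thompson_F" "g \<in> carrier thompson_F" "x \<in> {0..1}"
  shows "(f \<otimes>\<^bsub>thompson_F\<^esub> g) x = f (g x)"
  using assms by (simp add: thompson_F_def BijGroup_def compose_def)

lemma F_one_apply: "x \<in> {0..1} \<Longrightarrow> \<one>\<^bsub>thompson_F\<^esub> x = x"
  by (simp add: thompson_F_def BijGroup_def)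

lemma F_maps: "f \<in> carrier thompson_F \<Longrightarrow> x \<in> {0..1} \<Longrightarrow> f x \<in> {0..1}"
  unfolding thompson_F_carrier_iff Bij_def by (metis Int_iff bij_betwE mem_Collect_eq)

lemma F_inv_apply:
  assumes "f \<in> carrier thompson_F" "x \<in> {0..1}"
  shows "(inv\<^bsub>thompson_F\<^esub> f) (f x) = x" "f ((inv\<^bsub>thompson_F\<^esub> f) x) = x"
  using assms F_mult_apply[of "inv\<^bsub>thompson_F\<^esub> f" f x] F_mult_apply[of f "inv\<^bsub>thompson_F\<^esub> f" x]
  by (auto simp: F_one_apply)

lemma F_strict_mono: "f \<in> carrier thompson_F \<Longrightarrow> strict_mono_on {0..1} f"
  by (simp add: thompson_F_carrier_iff)

lemma F_eqI:
  assumes "f \<in> carrier thompson_F" "g \<in> carrier thompson_F" "\<And>x. x \<in> {0..1} \<Longrightarrow> f x = g x"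
  shows "f = g"
  using assms unfolding thompson_F_carrier_iff Bij_def
  by (metis (no_types, lifting) Int_iff extensionalityI)

lemma F_fixes_endpoints: "f \<in> carrier thompson_F \<Longrightarrow> f 0 = 0" "f \<in> carrier thompson_F \<Longrightarrow> f 1 = 1"
  using thompson_F_endpoints unfolding thompson_F_carrier_iff Bij_def by blast+

section \<open>Standard dyadic subdivisions\<close>

text \<open>
  The affine bijection from \<open>[a,b]\<close> to \<open>[c,d]\<close> is described by a common parameter \<open>s\<close> rather than by a
  formula in \<open>x\<close>. Composing two such maps, or inverting one, then only identifies parameters, and no
  division is needed.
\<close>

definition affine_piece :: "(real \<Rightarrow> real) \<Rightarrow> real \<Rightarrow> real \<Rightarrow> real \<Rightarrow> real \<Rightarrow> bool"
  where "affine_piece f a b c d \<longleftrightarrow> (\<forall>s\<in>{0..1}. f (a + s * (b - a)) = c + s * (d - c))"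

definition standard_interval :: "real \<Rightarrow> real \<Rightarrow> bool"
  where "standard_interval a b \<longleftrightarrow> (\<exists>m k::nat. a = real m / 2 ^ k \<and> b = (real m + 1) / 2 ^ k)"

definition subdivision :: "nat \<Rightarrow> (nat \<Rightarrow> real) \<Rightarrow> bool"
  where "subdivision n p \<longleftrightarrow> p 0 = 0 \<and> p n = 1 \<and> (\<forall>i<n. standard_interval (p i) (p (Suc i)))"

definition carries :: "(real \<Rightarrow> real) \<Rightarrow> nat \<Rightarrow> (nat \<Rightarrow> real) \<Rightarrow> (nat \<Rightarrow> real) \<Rightarrow> bool"
  where "carries f n p q \<longleftrightarrow> (\<forall>i<n. affine_piece f (p i) (p (Suc i)) (q i) (q (Suc i)))"

lemma affine_pieceD:
  assumes "affine_piece f a b c d" "a < b" "x \<in> {a..b}"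
  shows "f x = c + (x - a) / (b - a) * (d - c)"
proof -
  have "(x - a) / (b - a) \<in> {0..1}" using assms by (auto simp: divide_simps)
  moreover have "x = a + (x - a) / (b - a) * (b - a)" using assms by simp
  ultimately show ?thesis using assms(1) unfolding affine_piece_def by metis
qed

lemma affine_piece_ends:
  assumes "affine_piece f a b c d"
  shows "f a = c" "f b = d"
  using assms[unfolded affine_piece_def, rule_format, of 0]
    assms[unfolded affine_piece_def, rule_format, of 1] by simp_all

lemma standard_interval_less: "standard_interval a b \<Longrightarrow> a < b"
  unfolding standard_interval_def by (auto simp: divide_strict_right_mono)

lemma standard_interval_dyadic:
  assumes "standard_interval a b"
  shows "dyadic a" "dyadic b"
proof -
  obtain m k :: nat where "a = real m / 2 ^ k" "b = (real m + 1) / 2 ^ k"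
    using assms unfolding standard_interval_def by blast
  then have "a = real_of_int (int m) / 2 ^ k" "b = real_of_int (int m + 1) / 2 ^ k" by simp_all
  then show "dyadic a" "dyadic b" unfolding dyadic_def by blast+
qed

lemma standard_interval_length:
  assumes "standard_interval a b"
  shows "\<exists>k::nat. b - a = 1 / 2 ^ k"
proof -
  obtain m k :: nat where "a = real m / 2 ^ k" "b = (real m + 1) / 2 ^ k"
    using assms unfolding standard_interval_def by blast
  then have "b - a = 1 / 2 ^ k" by (simp add: diff_divide_distrib[symmetric])
  then show ?thesis by blast
qed

lemma subdivision_Suc_less: "subdivision n p \<Longrightarrow> i < n \<Longrightarrow> p i < p (Suc i)"
  unfolding subdivision_def using standard_interval_less by blast

lemma subdivision_mono:
  assumes "subdivision n p" "i \<le> j" "j \<le> n"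
  shows "p i \<le> p j"
  using assms(2,3)
proof (induction j rule: dec_induct)
  case (step j)
  then show ?case using subdivision_Suc_less[OF assms(1), of j] by simp
qed simp

lemma subdivision_in: "subdivision n p \<Longrightarrow> i \<le> n \<Longrightarrow> p i \<in> {0..1}"
  using subdivision_mono[of n p 0 i] subdivision_mono[of n p i n]
  unfolding subdivision_def by auto

lemma segment_point_in:
  fixes a b s :: real
  assumes "a \<le> b" "s \<in> {0..1}"
  shows "a + s * (b - a) \<in> {a..b}"
proof -
  have "s * (b - a) \<le> b - a" "0 \<le> s * (b - a)"
    using assms by (auto intro: mult_left_le_one_le)
  then show ?thesis by auto
qed

lemma subdivision_point_in:
  assumes p: "subdivision n p" and i: "i < n" and s: "s \<in> {0..1}"
  shows "p i + s * (p (Suc i) - p i) \<in> {p i..p (Suc i)}" "p i + s * (p (Suc i) - p i) \<in> {0..1}"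
proof -
  show *: "p i + s * (p (Suc i) - p i) \<in> {p i..p (Suc i)}"
    using subdivision_Suc_less[OF p i] s by (intro segment_point_in) auto
  show "p i + s * (p (Suc i) - p i) \<in> {0..1}"
    using * subdivision_in[OF p, of i] subdivision_in[OF p, of "Suc i"] i by auto
qed

lemma subdivision_pos: "subdivision n p \<Longrightarrow> n > 0"
  unfolding subdivision_def by (cases n) auto

lemma subdivision_locate:
  assumes p: "subdivision n p" and x: "0 \<le> x" "x < 1"
  obtains i where "i < n" "p i \<le> x" "x < p (Suc i)"
proof -
  define j where "j = (LEAST j. x < p j)"
  have "x < p n" using p x unfolding subdivision_def by simp
  then have j: "x < p j" "j \<le> n" unfolding j_def by (auto intro: LeastI Least_le)
  have "j \<noteq> 0" using j(1) x p unfolding subdivision_def by (cases j) auto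
  then obtain i where i: "j = Suc i" by (cases j) auto
  then have "p i \<le> x" using not_less_Least[of i "\<lambda>j. x < p j"] unfolding j_def by fastforce
  then show thesis using that[of i] j i by simp
qed

text \<open>
  For a map that is affine on every piece, this turns the set of subdivision points into a set of
  breakpoints in the sense of \<open>dyadic_piecewise_linear\<close>.
\<close>

lemma subdivision_locate_interval:
  assumes p: "subdivision n p" and ab: "0 \<le> a" "a < b" "b \<le> 1"
    and no: "\<And>j. j \<le> n \<Longrightarrow> p j \<notin> {a<..<b}"
  obtains i where "i < n" "p i \<le> a" "b \<le> p (Suc i)"
proof -
  obtain i where i: "i < n" "p i \<le> a" "a < p (Suc i)"
    using subdivision_locate[OF p, of a] ab by auto
  then have "b \<le> p (Suc i)" using no[of "Suc i"] by auto
  then show thesis using that i by blast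
qed

lemma carries_ends:
  assumes "carries f n p q" "i < n"
  shows "f (p i) = q i" "f (p (Suc i)) = q (Suc i)"
  using assms affine_piece_ends unfolding carries_def by blast+

lemma carries_at:
  assumes "carries f n p q" "i \<le> n" "n > 0"
  shows "f (p i) = q i"
  using carries_ends[OF assms(1)] assms by (cases i) (auto simp: less_eq_Suc_le)

lemma carries_piece_less:
  assumes p: "subdivision n p" and q: "subdivision n q" and f: "carries f n p q" and i: "i < n"
    and xy: "p i \<le> x" "x < y" "y \<le> p (Suc i)"
  shows "f x < f y"
proof -
  have a: "affine_piece f (p i) (p (Suc i)) (q i) (q (Suc i))" using f i unfolding carries_def by blast
  have pq: "p i < p (Suc i)" "q i < q (Suc i)" using subdivision_Suc_less p q i by auto
  have "f x = q i + (x - p i) / (p (Suc i) - p i) * (q (Suc i) - q i)"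
    "f y = q i + (y - p i) / (p (Suc i) - p i) * (q (Suc i) - q i)"
    using affine_pieceD[OF a pq(1)] xy by auto
  moreover have "(x - p i) / (p (Suc i) - p i) * (q (Suc i) - q i)
      < (y - p i) / (p (Suc i) - p i) * (q (Suc i) - q i)"
    using pq xy by (intro mult_strict_right_mono divide_strict_right_mono) auto
  ultimately show ?thesis by linarith
qed

text \<open>
  Monotonicity is proved within a piece and then across pieces via the common subdivision values. The
  slope on a piece is a quotient of lengths of standard intervals, hence a power of \<open>2\<close>. This is the
  way in which concrete elements of \<open>F\<close> are recognised below.
\<close>

lemma carries_imp_carrier:
  assumes ext: "f \<in> extensional {0..1}"
    and p: "subdivision n p" and q: "subdivision n q" and f: "carries f n p q"
  shows "f \<in> carrier thompson_F"
proof -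
  let ?I = "{0..1::real}"
  have n: "n > 0" using subdivision_pos[OF p] .
  have p0: "p 0 = 0" "p n = 1" and q0: "q 0 = 0" "q n = 1" using p q unfolding subdivision_def by auto
  have mono: "strict_mono_on ?I f"
  proof (rule strict_mono_onI)
    fix x y :: real assume xy: "x \<in> ?I" "y \<in> ?I" "x < y"
    obtain i where i: "i < n" "p i \<le> x" "x < p (Suc i)"
      using subdivision_locate[OF p, of x] xy by auto
    have lt: "f x < q (Suc i)"
      using carries_piece_less[OF p q f i(1,2,3)] carries_ends[OF f i(1)] by simp
    show "f x < f y"
    proof (cases "y \<le> p (Suc i)")
      case True then show ?thesis using carries_piece_less[OF p q f i(1,2) xy(3)] by simp
    next
      case False
      show ?thesis
      proof (cases "y = 1")
        case True
        then have "f y = q n" using carries_at[OF f, of n] n p0 by simp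
        then show ?thesis using lt subdivision_mono[OF q, of "Suc i" n] i by simp
      next
        case y1: False
        obtain j where j: "j < n" "p j \<le> y" "y < p (Suc j)"
          using subdivision_locate[OF p, of y] xy y1 by auto
        have "Suc i \<le> j"
          using subdivision_mono[OF p, of "Suc j" "Suc i"] False j i by (rule_tac ccontr) simp
        then have "q (Suc i) \<le> q j" using subdivision_mono[OF q] j by simp
        also have "q j \<le> f y"
          using carries_piece_less[OF p q f j(1), of "p j" y] carries_ends[OF f j(1)] j
          by (cases "p j = y") auto
        finally show ?thesis using lt by simp
      qed
    qed
  qed
  have f0: "f 0 = 0" "f 1 = 1"
    using carries_at[OF f, of 0] carries_at[OF f, of n] n p0 q0 by auto
  have "f ` ?I = ?I"
  proof (intro equalityI subsetI)
    fix y assume "y \<in> f ` ?I"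
    then obtain x where x: "x \<in> ?I" "y = f x" by blast
    have "f 0 \<le> f x" "f x \<le> f 1"
      using x by (auto intro!: strict_mono_on_leD[OF mono])
    then show "y \<in> ?I" using f0 x by simp
  next
    fix y assume y: "y \<in> ?I"
    show "y \<in> f ` ?I"
    proof (cases "y = 1")
      case True then show ?thesis using f0 by force
    next
      case False
      then obtain i where i: "i < n" "q i \<le> y" "y < q (Suc i)"
        using subdivision_locate[OF q, of y] y by auto
      define s where "s = (y - q i) / (q (Suc i) - q i)"
      have s: "s \<in> {0..1}" using i unfolding s_def by (auto simp: divide_simps)
      have "f (p i + s * (p (Suc i) - p i)) = q i + s * (q (Suc i) - q i)"
        using f i s unfolding carries_def affine_piece_def by blast
      also have "\<dots> = y" using i unfolding s_def by simp
      finally have "f (p i + s * (p (Suc i) - p i)) = y" .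
      moreover have "p i + s * (p (Suc i) - p i) \<in> ?I" using subdivision_point_in[OF p i(1) s] by blast
      ultimately show ?thesis by blast
    qed
  qed
  then have bij: "bij_betw f ?I ?I"
    using strict_mono_on_imp_inj_on[OF mono] by (simp add: bij_betw_def)
  have "continuous_on (\<Union>i\<in>{..<n}. {p i..p (Suc i)}) f"
  proof (rule continuous_on_closed_Union)
    fix i assume "i \<in> {..<n}"
    then have i: "i < n" by simp
    have a: "affine_piece f (p i) (p (Suc i)) (q i) (q (Suc i))"
      using f i unfolding carries_def by blast
    have "p i < p (Suc i)" using subdivision_Suc_less p i by auto
    then have "f x = q i + (x - p i) / (p (Suc i) - p i) * (q (Suc i) - q i)"
      if "x \<in> {p i..p (Suc i)}" for x
      using affine_pieceD[OF a _ that] by blast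
    moreover have "continuous_on {p i..p (Suc i)}
       (\<lambda>x. q i + (x - p i) / (p (Suc i) - p i) * (q (Suc i) - q i))"
      using \<open>p i < p (Suc i)\<close> by (intro continuous_intros) auto
    ultimately show "continuous_on {p i..p (Suc i)} f"
      by (subst continuous_on_cong[OF refl]) auto
  qed auto
  moreover have "(\<Union>i\<in>{..<n}. {p i..p (Suc i)}) = ?I"
  proof (intro equalityI subsetI)
    fix x assume "x \<in> (\<Union>i\<in>{..<n}. {p i..p (Suc i)})"
    then obtain i where "i < n" "p i \<le> x" "x \<le> p (Suc i)" by auto
    then show "x \<in> ?I" using subdivision_in[OF p, of i] subdivision_in[OF p, of "Suc i"] by auto
  next
    fix x assume x: "x \<in> ?I"
    show "x \<in> (\<Union>i\<in>{..<n}. {p i..p (Suc i)})"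
    proof (cases "x = 1")
      case True
      have "p (n - 1) \<in> ?I" "Suc (n - 1) = n" using subdivision_in[OF p] n by auto
      then show ?thesis using True n p0 by (intro UN_I[of "n - 1"]) auto
    next
      case False
      then obtain i where "i < n" "p i \<le> x" "x < p (Suc i)"
        using subdivision_locate[OF p, of x] x by auto
      then show ?thesis by (intro UN_I[of i]) auto
    qed
  qed
  ultimately have cont: "continuous_on ?I f" by simp
  have "dyadic_piecewise_linear f"
    unfolding dyadic_piecewise_linear_def
  proof (intro exI[of _ "p ` {..n}"] conjI allI impI ballI)
    show "p ` {..n} \<subseteq> ?I" using subdivision_in[OF p] by auto
  next
    fix x assume "x \<in> p ` {..n}"
    then obtain j where j: "j \<le> n" "x = p j" by auto
    show "dyadic x"
    proof (cases "j = n")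
      case True
      then have "x = p (Suc (n - 1))" "n - 1 < n" using j n by auto
      then show ?thesis using p standard_interval_dyadic unfolding subdivision_def by metis
    next
      case False
      then show ?thesis using j p standard_interval_dyadic unfolding subdivision_def
        by (metis le_neq_implies_less)
    qed
  next
    fix a b assume ab: "0 \<le> a \<and> a < b \<and> b \<le> 1 \<and> {a<..<b} \<inter> p ` {..n} = {}"
    then have "\<And>j. j \<le> n \<Longrightarrow> p j \<notin> {a<..<b}" by blast
    then obtain i where i: "i < n" "p i \<le> a" "b \<le> p (Suc i)"
      using subdivision_locate_interval[OF p, of a b] ab by blast
    have a: "affine_piece f (p i) (p (Suc i)) (q i) (q (Suc i))"
      using f i unfolding carries_def by blast
    have pl: "p i < p (Suc i)" using subdivision_Suc_less p i by auto
    obtain k l :: nat where kl: "p (Suc i) - p i = 1 / 2 ^ k" "q (Suc i) - q i = 1 / 2 ^ l"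
      using p q i standard_interval_length unfolding subdivision_def by meson
    have "f x = 2 powi (int k - int l) * x + (q i - 2 powi (int k - int l) * p i)"
      if "x \<in> {a..b}" for x
    proof -
      have "x \<in> {p i..p (Suc i)}" using that i by auto
      then have "f x = q i + (x - p i) / (p (Suc i) - p i) * (q (Suc i) - q i)"
        using affine_pieceD[OF a pl] by blast
      also have "\<dots> = q i + 2 powi (int k - int l) * (x - p i)"
        unfolding kl by (simp add: power_int_diff)
      finally show ?thesis by (simp add: algebra_simps)
    qed
    then show "\<exists>(k::int) (c::real). \<forall>x\<in>{a..b}. f x = 2 powi k * x + c" by blast
  qed simp
  then show ?thesis
    using ext bij mono cont unfolding thompson_F_carrier_iff Bij_def by blast
qed

lemma dyadic_eventually_integral:
  assumes "dyadic x"
  shows "\<exists>K::nat. \<forall>k\<ge>K. x * 2 ^ k \<in> \<int>"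
proof -
  obtain m n where x: "x = real_of_int m / 2 ^ n" using assms unfolding dyadic_def by blast
  have "x * 2 ^ k \<in> \<int>" if "k \<ge> n" for k
  proof -
    have "(2::real) ^ k = 2 ^ n * 2 ^ (k - n)" using that by (simp add: power_add[symmetric])
    then have "x * 2 ^ k = real_of_int (m * 2 ^ (k - n))" unfolding x by simp
    then show ?thesis by (metis Ints_of_int)
  qed
  then show ?thesis by blast
qed

lemma finite_uniform_bound:
  fixes Q :: "'a \<Rightarrow> nat \<Rightarrow> bool"
  assumes "finite S" "\<And>x. x \<in> S \<Longrightarrow> \<exists>K. \<forall>k\<ge>K. Q x k"
  shows "\<exists>K. \<forall>k\<ge>K. \<forall>x\<in>S. Q x k"
proof -
  have "eventually (\<lambda>k. \<forall>x\<in>S. Q x k) sequentially"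
    using assms by (intro eventually_ball_finite) (auto simp: eventually_sequentially)
  then show ?thesis by (simp add: eventually_sequentially)
qed

text \<open>
  An affine map with slope \<open>2^k\<close> need not map standard intervals to standard intervals, since the
  image may start at the wrong place. On a fine enough scale it does: once the image length \<open>2^(k-r)\<close>
  divides the dyadic number \<open>u\<close>, all translates by multiples of it start at a multiple of it.
\<close>

lemma standard_image_eventually:
  assumes u: "dyadic u" "u \<ge> 0"
  shows "\<exists>R. \<forall>r\<ge>R. \<forall>j::nat. standard_interval (u + 2 powi k * (real j / 2 ^ r))
           (u + 2 powi k * ((real j + 1) / 2 ^ r))"
proof -
  obtain K where K: "\<And>k. k \<ge> K \<Longrightarrow> u * 2 ^ k \<in> \<int>" using dyadic_eventually_integral[OF u(1)] by blast
  have "standard_interval (u + 2 powi k * (real j / 2 ^ r)) (u + 2 powi k * ((real j + 1) / 2 ^ r))"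
    if r: "r \<ge> K + nat \<bar>k\<bar>" for r j :: nat
  proof -
    define e where "e = nat (int r - k)"
    have e: "int e = int r - k" "e \<ge> K" using r unfolding e_def by auto
    have "(2::real) powi int e = 2 powi int r / 2 powi k" unfolding e(1) by (simp add: power_int_diff)
    then have pe: "2 powi k * (y / 2 ^ r) = y / (2::real) ^ e" for y by simp
    obtain z where z: "u * 2 ^ e = real_of_int z" using K[OF e(2)] by (auto elim: Ints_cases)
    have "real_of_int z \<ge> 0" unfolding z[symmetric] using u by simp
    then have z': "u = real (nat z) / 2 ^ e" using z by (simp add: field_simps)
    show ?thesis unfolding standard_interval_def pe
      by (intro exI[of _ "nat z + j"] exI[of _ e]) (simp add: z' add_divide_distrib)
  qed
  then show ?thesis by blast
qed

text \<open>
  The source subdivision is uniform. A first mesh \<open>2^-N\<close> is fine enough to contain all breakpoints; a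
  further refinement by \<open>2^-R\<close> makes all images standard intervals.
\<close>

lemma carrier_imp_carries:
  assumes f: "f \<in> carrier thompson_F"
  shows "\<exists>n p q. subdivision n p \<and> subdivision n q \<and> carries f n p q"
proof -
  let ?I = "{0..1::real}"
  have pl: "dyadic_piecewise_linear f" and f01: "f 0 = 0" "f 1 = 1"
    using f F_fixes_endpoints by (auto simp: thompson_F_carrier_iff)
  then obtain P where P: "finite P" "\<And>x. x \<in> P \<Longrightarrow> dyadic x" "P \<subseteq> ?I"
      and lin: "\<And>a b. 0 \<le> a \<Longrightarrow> a < b \<Longrightarrow> b \<le> 1 \<Longrightarrow> {a<..<b} \<inter> P = {} \<Longrightarrow>
        (\<exists>(k::int) (c::real). \<forall>x\<in>{a..b}. f x = 2 powi k * x + c)"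
    unfolding dyadic_piecewise_linear_def by metis
  have "\<exists>N. \<forall>k\<ge>N. \<forall>x\<in>P. x * 2 ^ k \<in> \<int>"
    using P dyadic_eventually_integral by (intro finite_uniform_bound) auto
  then obtain N where N: "\<And>x. x \<in> P \<Longrightarrow> x * 2 ^ N \<in> \<int>" by blast
  define u where "u i = real i / 2 ^ N" for i
  have uI: "u i \<in> ?I" if "i \<le> 2 ^ N" for i using that by (simp add: u_def divide_simps)
  have u_less: "u i < u (Suc i)" for i by (simp add: u_def divide_strict_right_mono)
  have slope: "\<exists>k. \<forall>x\<in>{u i..u (Suc i)}. f x = f (u i) + 2 powi k * (x - u i)" if i: "i < 2 ^ N" for i
  proof -
    have "x \<notin> P" if x: "x \<in> {u i<..<u (Suc i)}" for x
    proof
      assume "x \<in> P"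
      then obtain z where z: "x * 2 ^ N = real_of_int z" using N by (auto elim: Ints_cases)
      have "real i < x * 2 ^ N" "x * 2 ^ N < real (Suc i)"
        using x by (auto simp: u_def field_simps)
      then have "of_int (int i) < (of_int z :: real)" "of_int z < (of_int (int i + 1) :: real)"
        unfolding z by simp_all
      then show False unfolding of_int_less_iff by linarith
    qed
    then have "{u i<..<u (Suc i)} \<inter> P = {}" by auto
    then obtain k c where kc: "\<forall>x\<in>{u i..u (Suc i)}. f x = 2 powi k * x + c"
      using lin[of "u i" "u (Suc i)"] uI[of i] uI[of "Suc i"] i u_less by auto
    have "f x = f (u i) + 2 powi k * (x - u i)" if "x \<in> {u i..u (Suc i)}" for x
      using kc that u_less[of i] by (simp add: algebra_simps)
    then show ?thesis by blast
  qed
  then have "\<exists>k. \<forall>i. i < 2 ^ N \<longrightarrow> (\<forall>x\<in>{u i..u (Suc i)}. f x = f (u i) + 2 powi (k i) * (x - u i))"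
    by metis
  then obtain k where k: "\<And>i x. i < 2 ^ N \<Longrightarrow> x \<in> {u i..u (Suc i)} \<Longrightarrow>
      f x = f (u i) + 2 powi (k i) * (x - u i)" by blast
  have fu: "dyadic (f (u i))" "f (u i) \<ge> 0" if "i < 2 ^ N" for i
  proof -
    have "u i = real_of_int (int i) / 2 ^ N" by (simp add: u_def)
    then have "dyadic (u i)" unfolding dyadic_def by blast
    then show "dyadic (f (u i))" using dyadic_image[OF pl f01(1) uI] that by simp
    show "f (u i) \<ge> 0" using F_maps[OF f uI[of i]] that by simp
  qed
  have "\<exists>R. \<forall>r\<ge>R. \<forall>i\<in>{..<2 ^ N}. \<forall>j::nat.
      standard_interval (f (u i) + 2 powi k i * (real j / 2 ^ r))
           (f (u i) + 2 powi k i * ((real j + 1) / 2 ^ r))"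
    using fu standard_image_eventually by (intro finite_uniform_bound) auto
  then obtain R where R: "\<And>r i j. r \<ge> R \<Longrightarrow> i < 2 ^ N \<Longrightarrow>
      standard_interval (f (u i) + 2 powi k i * (real j / 2 ^ r))
           (f (u i) + 2 powi k i * ((real j + 1) / 2 ^ r))" by blast
  define M where "M = N + R"
  define p where "p l = real l / 2 ^ M" for l
  have std: "standard_interval (p l) (p (Suc l))" for l
    unfolding standard_interval_def p_def by (intro exI[of _ l] exI[of _ M]) simp
  have main: "standard_interval (f (p l)) (f (p (Suc l))) \<and>
      affine_piece f (p l) (p (Suc l)) (f (p l)) (f (p (Suc l)))" if l: "l < 2 ^ M" for l
  proof -
    \<comment> \<open>Cell \<open>l\<close> of the fine mesh is the \<open>j\<close>-th cell inside cell \<open>i\<close> of the coarse mesh.\<close>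
    define i j where "i = l div 2 ^ R" and "j = l mod 2 ^ R"
    have lij: "l = i * 2 ^ R + j" unfolding i_def j_def by (rule div_mult_mod_eq[symmetric])
    have j: "j < 2 ^ R" unfolding j_def by simp
    have i: "i < 2 ^ N" unfolding i_def using l by (simp add: M_def power_add less_mult_imp_div_less)
    have pl: "p (i * 2 ^ R + j') = u i + real j' / 2 ^ M" for j'
      by (simp add: p_def u_def M_def power_add add_divide_distrib)
    have uS: "u (Suc i) = u i + 2 ^ R / 2 ^ M"
      by (simp add: u_def M_def power_add add_divide_distrib)
    have in1: "u i + y / 2 ^ M \<in> {u i..u (Suc i)}" if "0 \<le> y" "y \<le> 2 ^ R" for y
      unfolding uS using that by (auto simp: divide_right_mono)
    have f1: "f (u i + y / 2 ^ M) = f (u i) + 2 powi k i * (y / 2 ^ M)" if "0 \<le> y" "y \<le> 2 ^ R" for y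
      using k[OF i in1[OF that]] by simp
    have jr: "real j + 1 \<le> 2 ^ R"
      using j by (metis Suc_leI of_nat_Suc of_nat_le_iff of_nat_numeral of_nat_power add.commute)
    have e: "p l = u i + real j / 2 ^ M" "p (Suc l) = u i + (real j + 1) / 2 ^ M"
      using pl[of j] pl[of "Suc j"] unfolding lij by (simp_all add: add.commute)
    have fe: "f (p l) = f (u i) + 2 powi k i * (real j / 2 ^ M)"
      "f (p (Suc l)) = f (u i) + 2 powi k i * ((real j + 1) / 2 ^ M)"
      unfolding e using j f1[of "real j"] f1[of "real j + 1"] jr by simp_all
    have "standard_interval (f (p l)) (f (p (Suc l)))"
      unfolding fe using R[of M i j] i by (simp add: M_def)
    moreover have "affine_piece f (p l) (p (Suc l)) (f (p l)) (f (p (Suc l)))"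
      unfolding affine_piece_def
    proof
      fix s :: real assume s: "s \<in> {0..1}"
      have "p l + s * (p (Suc l) - p l) = u i + (real j + s) / 2 ^ M"
        unfolding e by (simp add: add_divide_distrib)
      moreover have "f (u i + (real j + s) / 2 ^ M) = f (u i) + 2 powi k i * ((real j + s) / 2 ^ M)"
        using s jr by (intro f1) auto
      ultimately show "f (p l + s * (p (Suc l) - p l)) = f (p l) + s * (f (p (Suc l)) - f (p l))"
        unfolding fe by (simp add: algebra_simps add_divide_distrib)
    qed
    ultimately show ?thesis by blast
  qed
  have "subdivision (2 ^ M) p"
    unfolding subdivision_def using std by (simp add: p_def)
  moreover have "subdivision (2 ^ M) (f \<circ> p)"
    unfolding subdivision_def using main f01 by (simp add: p_def)
  moreover have "carries f (2 ^ M) p (f \<circ> p)"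
    unfolding carries_def using main by simp
  ultimately show ?thesis by blast
qed

section \<open>Finite generation of F\<close>

lemma standard_intervalI:
  "a = real m / 2 ^ k \<Longrightarrow> b = (real m + 1) / 2 ^ k \<Longrightarrow> standard_interval a b"
  unfolding standard_interval_def by blast

lemma carries_compose:
  assumes f: "f \<in> carrier thompson_F" and g: "g \<in> carrier thompson_F"
    and p: "subdivision n p" and fp: "carries f n p q" and gq: "carries g n q r"
  shows "carries (g \<otimes>\<^bsub>thompson_F\<^esub> f) n p r"
  unfolding carries_def affine_piece_def
proof (intro allI impI ballI)
  fix i and s :: real assume i: "i < n" and s: "s \<in> {0..1}"
  have "p i + s * (p (Suc i) - p i) \<in> {0..1}" by (rule subdivision_point_in[OF p i s])
  then show "(g \<otimes>\<^bsub>thompson_F\<^esub> f) (p i + s * (p (Suc i) - p i)) = r i + s * (r (Suc i) - r i)"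
    using fp gq i s unfolding carries_def affine_piece_def by (simp add: F_mult_apply[OF g f])
qed

lemma carries_inv:
  assumes f: "f \<in> carrier thompson_F" and p: "subdivision n p" and fp: "carries f n p q"
  shows "carries (inv\<^bsub>thompson_F\<^esub> f) n q p"
  unfolding carries_def affine_piece_def
proof (intro allI impI ballI)
  fix i and s :: real assume i: "i < n" and s: "s \<in> {0..1}"
  have I: "p i + s * (p (Suc i) - p i) \<in> {0..1}" by (rule subdivision_point_in[OF p i s])
  have "f (p i + s * (p (Suc i) - p i)) = q i + s * (q (Suc i) - q i)"
    using fp i s unfolding carries_def affine_piece_def by simp
  then show "(inv\<^bsub>thompson_F\<^esub> f) (q i + s * (q (Suc i) - q i)) = p i + s * (p (Suc i) - p i)"
    using F_inv_apply(1)[OF f I] by simp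
qed

text \<open>
  It maps \<open>[0,1/4]\<close>, \<open>[1/4,1/2]\<close>, \<open>[1/2,1]\<close> onto \<open>[0,1/2]\<close>, \<open>[1/2,3/4]\<close>, \<open>[3/4,1]\<close>. Up to inversion this
  is the generator of \<open>F\<close> that is commonly called \<open>x_0\<close>; the element \<open>rscale x0\<close> below is then \<open>x_1\<close>.
\<close>

definition x0 :: "real \<Rightarrow> real"
  where "x0 = (\<lambda>x\<in>{0..1}. if x \<le> 1/4 then 2 * x else if x \<le> 1/2 then x + 1/4 else (x + 1) / 2)"

lemma x0_carrier: "x0 \<in> carrier thompson_F"
proof (rule carries_imp_carrier)
  let ?p = "(!) [0, 1/4, 1/2, 1 :: real]" and ?q = "(!) [0, 1/2, 3/4, 1 :: real]"
  show "x0 \<in> extensional {0..1}" by (simp add: x0_def)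
  have less_3: "i < 3 \<longleftrightarrow> i = 0 \<or> i = 1 \<or> i = 2" for i :: nat by auto
  show "subdivision 3 ?p"
    unfolding subdivision_def less_3
    using standard_intervalI[of 0 0 2 "1/4"] standard_intervalI[of "1/4" 1 2 "1/2"]
      standard_intervalI[of "1/2" 1 1 1] by (auto simp: numeral_eq_Suc)
  show "subdivision 3 ?q"
    unfolding subdivision_def less_3
    using standard_intervalI[of 0 0 1 "1/2"] standard_intervalI[of "1/2" 2 2 "3/4"]
      standard_intervalI[of "3/4" 3 2 1] by (auto simp: numeral_eq_Suc)
  show "carries x0 3 ?p ?q"
    unfolding carries_def less_3 affine_piece_def x0_def
    by (auto simp: numeral_eq_Suc field_simps)
qed

text \<open>
  The conjugate of \<open>f\<close> by the affine map from \<open>[0,1]\<close> onto \<open>[1/2,1]\<close>, extended by the identity.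
\<close>

definition rscale :: "(real \<Rightarrow> real) \<Rightarrow> real \<Rightarrow> real"
  where "rscale f = (\<lambda>x\<in>{0..1}. if x \<le> 1/2 then x else (1 + f (2 * x - 1)) / 2)"

lemma standard_interval_right_half:
  assumes "standard_interval a b"
  shows "standard_interval ((1 + a) / 2) ((1 + b) / 2)"
proof -
  obtain m k :: nat where "a = real m / 2 ^ k" "b = (real m + 1) / 2 ^ k"
    using assms unfolding standard_interval_def by blast
  then show ?thesis
    by (intro standard_intervalI[of _ "m + 2 ^ k" "Suc k"]) (auto simp: field_simps)
qed

lemma subdivision_right_half:
  assumes "subdivision n p"
  shows "subdivision (Suc n) (\<lambda>i. case i of 0 \<Rightarrow> 0 | Suc j \<Rightarrow> (1 + p j) / 2)"
  unfolding subdivision_def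
proof (intro conjI allI impI)
  fix i assume "i < Suc n"
  then show "standard_interval (case i of 0 \<Rightarrow> 0 | Suc j \<Rightarrow> (1 + p j) / 2)
      (case Suc i of 0 \<Rightarrow> 0 | Suc j \<Rightarrow> (1 + p j) / 2)"
    using assms standard_intervalI[of 0 0 1 "1/2"] standard_interval_right_half
    unfolding subdivision_def by (cases i) auto
qed (use assms in \<open>auto simp: subdivision_def\<close>)

lemma rscale_low: "0 \<le> x \<Longrightarrow> x \<le> 1/2 \<Longrightarrow> rscale f x = x"
  by (simp add: rscale_def)

lemma rscale_high: "1/2 < x \<Longrightarrow> x \<le> 1 \<Longrightarrow> rscale f x = (1 + f (2 * x - 1)) / 2"
  by (simp add: rscale_def)

lemma rscale_half:
  assumes "0 < y" "y \<le> 1"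
  shows "rscale f ((1 + y) / 2) = (1 + f y) / 2"
proof -
  have "2 * ((1 + y) / 2) - 1 = y" by (simp add: field_simps)
  then show ?thesis using assms rscale_high[of "(1 + y) / 2" f] by (simp only:)
qed

lemma rscale_carrier:
  assumes f: "f \<in> carrier thompson_F"
  shows "rscale f \<in> carrier thompson_F"
proof -
  obtain n p q where pq: "subdivision n p" "subdivision n q" "carries f n p q"
    using carrier_imp_carries[OF f] by blast
  let ?s = "\<lambda>p::nat \<Rightarrow> real. \<lambda>i. case i of 0 \<Rightarrow> 0 | Suc j \<Rightarrow> (1 + p j) / 2"
  show ?thesis
  proof (rule carries_imp_carrier)
    show "rscale f \<in> extensional {0..1}" by (simp add: rscale_def)
    show "subdivision (Suc n) (?s p)" "subdivision (Suc n) (?s q)"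
      using pq subdivision_right_half by blast+
    show "carries (rscale f) (Suc n) (?s p) (?s q)"
      unfolding carries_def
    proof (intro allI impI)
      fix i assume i: "i < Suc n"
      show "affine_piece (rscale f) (?s p i) (?s p (Suc i)) (?s q i) (?s q (Suc i))"
      proof (cases i)
        case 0
        have "p 0 = 0" "q 0 = 0" using pq unfolding subdivision_def by auto
        then show ?thesis unfolding 0 affine_piece_def rscale_def by auto
      next
        case (Suc j)
        then have j: "j < n" using i by simp
        show ?thesis unfolding affine_piece_def
        proof
          fix s :: real assume s: "s \<in> {0..1}"
          define x where "x = p j + s * (p (Suc j) - p j)"
          have fx: "f x = q j + s * (q (Suc j) - q j)"
            using pq(3) j s unfolding carries_def affine_piece_def x_def by simp
          have xI: "x \<in> {0..1}" unfolding x_def by (rule subdivision_point_in[OF pq(1) j s])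
          have "rscale f ((1 + x) / 2) = (1 + f x) / 2"
          proof (cases "x = 0")
            case True
            then show ?thesis using F_fixes_endpoints(1)[OF f] by (simp add: rscale_def)
          next
            case False
            then show ?thesis using xI rscale_half[of x f] by auto
          qed
          moreover have "?s p i + s * (?s p (Suc i) - ?s p i) = (1 + x) / 2"
            unfolding Suc x_def by (simp add: field_simps)
          moreover have "?s q i + s * (?s q (Suc i) - ?s q i) = (1 + f x) / 2"
            unfolding Suc fx by (simp add: field_simps)
          ultimately show "rscale f (?s p i + s * (?s p (Suc i) - ?s p i))
              = ?s q i + s * (?s q (Suc i) - ?s q i)" by (simp only:)
        qed
      qed
    qed
  qed
qed

lemma F_pos: "f \<in> carrier thompson_F \<Longrightarrow> 0 < x \<Longrightarrow> x \<le> 1 \<Longrightarrow> 0 < f x"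
  using strict_mono_onD[OF F_strict_mono, of f 0 x] F_fixes_endpoints(1)[of f] by simp

lemma rscale_high_gt:
  assumes "f \<in> carrier thompson_F" "1/2 < x" "x \<le> 1"
  shows "rscale f x \<in> {1/2<..1}"
  using F_pos[OF assms(1), of "2 * x - 1"] F_maps[OF assms(1), of "2 * x - 1"] assms
  by (simp add: rscale_high)

lemma rscale_mult:
  assumes f: "f \<in> carrier thompson_F" and g: "g \<in> carrier thompson_F"
  shows "rscale (f \<otimes>\<^bsub>thompson_F\<^esub> g) = rscale f \<otimes>\<^bsub>thompson_F\<^esub> rscale g"
proof (rule F_eqI)
  fix x :: real assume x: "x \<in> {0..1}"
  show "rscale (f \<otimes>\<^bsub>thompson_F\<^esub> g) x = (rscale f \<otimes>\<^bsub>thompson_F\<^esub> rscale g) x"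
  proof (cases "x \<le> 1/2")
    case True
    then show ?thesis using x by (simp add: F_mult_apply rscale_carrier f g rscale_low)
  next
    case False
    then have "0 < g (2 * x - 1)" "g (2 * x - 1) \<le> 1" "rscale g x = (1 + g (2 * x - 1)) / 2"
      using F_pos[OF g, of "2 * x - 1"] F_maps[OF g, of "2 * x - 1"] x by (auto simp: rscale_high)
    then have "rscale f (rscale g x) = (1 + f (g (2 * x - 1))) / 2"
      using rscale_half[of "g (2 * x - 1)" f] by (simp only:)
    then show ?thesis
      using False x by (simp add: F_mult_apply rscale_carrier f g rscale_high)
  qed
qed (use f g rscale_carrier F.m_closed in auto)

interpretation rscale: group_hom thompson_F thompson_F rscale
  by unfold_locales (auto simp: hom_def rscale_carrier rscale_mult)

text \<open>
  Since \<open>x0\<close> maps \<open>[1/2,1]\<close> affinely onto \<open>[3/4,1]\<close>, it conjugates the copy of \<open>f\<close> on the former to the copy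
  on the latter, which is the twice rescaled \<open>f\<close>.
\<close>

lemma x0_shifts_rscale:
  assumes f: "f \<in> carrier thompson_F"
  shows "rscale (rscale f) = x0 \<otimes>\<^bsub>thompson_F\<^esub> rscale f \<otimes>\<^bsub>thompson_F\<^esub> inv\<^bsub>thompson_F\<^esub> x0"
proof -
  note rf = rscale_carrier[OF f] and rrf = rscale_carrier[OF rscale_carrier[OF f]]
  have "rscale (rscale f) \<otimes>\<^bsub>thompson_F\<^esub> x0 = x0 \<otimes>\<^bsub>thompson_F\<^esub> rscale f"
  proof (rule F_eqI)
    fix x :: real assume x: "x \<in> {0..1}"
    have "rscale (rscale f) (x0 x) = x0 (rscale f x)"
    proof (cases "x \<le> 1/2")
      case True
      then have "x0 x \<in> {0..3/4}" using x by (auto simp: x0_def)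
      then have "rscale (rscale f) (x0 x) = x0 x"
        by (cases "x0 x \<le> 1/2") (auto simp: rscale_low rscale_high)
      then show ?thesis using True x by (simp add: rscale_low)
    next
      case False
      then have e: "x0 x = (x + 1) / 2" using x by (simp add: x0_def)
      have y: "rscale f x \<in> {1/2<..1}" using rscale_high_gt[OF f, of x] x False by simp
      then have "x0 (rscale f x) = (rscale f x + 1) / 2" by (simp add: x0_def)
      moreover have "rscale (rscale f) ((x + 1) / 2) = (1 + rscale f x) / 2"
        using x False rscale_half[of x "rscale f"] by (simp add: add.commute)
      ultimately show ?thesis unfolding e by simp
    qed
    then show "(rscale (rscale f) \<otimes>\<^bsub>thompson_F\<^esub> x0) x = (x0 \<otimes>\<^bsub>thompson_F\<^esub> rscale f) x"
      using x by (simp add: F_mult_apply rf rrf x0_carrier)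
  qed (use rf rrf x0_carrier F.m_closed in auto)
  then show ?thesis
    using rf rrf x0_carrier by (metis F.inv_solve_right' F.m_closed)
qed

lemma rscale_generate:
  assumes "f \<in> generate thompson_F {x0, rscale x0}"
  shows "rscale f \<in> generate thompson_F {x0, rscale x0}"
proof -
  let ?H = "generate thompson_F {x0, rscale x0}"
  have sub: "{x0, rscale x0} \<subseteq> carrier thompson_F" using x0_carrier rscale_carrier by blast
  interpret H: subgroup ?H thompson_F using F.generate_is_subgroup[OF sub] .
  have x: "x0 \<in> ?H" "rscale x0 \<in> ?H" by (auto intro: generate.incl)
  then have gens: "rscale h \<in> ?H" if "h \<in> {x0, rscale x0}" for h
    using that x0_shifts_rscale[OF x0_carrier] H.m_closed H.m_inv_closed by auto
  show ?thesis using assms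
  proof (induction rule: generate.induct)
    case one then show ?case using H.one_closed by simp
  next
    case (incl h) then show ?case using gens by blast
  next
    case (inv h)
    then have "h \<in> carrier thompson_F" "rscale h \<in> ?H" using sub gens by blast+
    then show ?case using H.m_inv_closed by simp
  next
    case (eng h1 h2)
    then have "h1 \<in> carrier thompson_F" "h2 \<in> carrier thompson_F"
      using H.subset by auto
    then show ?case using eng H.m_closed by simp
  qed
qed

lemma affine_pieceI:
  assumes ab: "a < b" and f: "\<And>x. a \<le> x \<Longrightarrow> x \<le> b \<Longrightarrow> f x = u * x + v"
  shows "affine_piece f a b (f a) (f b)"
  unfolding affine_piece_def
proof
  fix s :: real assume "s \<in> {0..1}"
  then have "a + s * (b - a) \<in> {a..b}" using ab by (intro segment_point_in) auto
  then have "f (a + s * (b - a)) = u * (a + s * (b - a)) + v" by (intro f) auto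
  then show "f (a + s * (b - a)) = f a + s * (f b - f a)"
    using f[of a] f[of b] ab by (simp add: algebra_simps)
qed

text \<open>
  A standard interval that does not contain \<open>0\<close> is never cut by the breakpoints \<open>1/4\<close> and \<open>1/2\<close> of \<open>x0\<close>,
  by nestedness of standard intervals: the only ones with \<open>1/4\<close> or \<open>1/2\<close> in the interior are \<open>[0,1/2]\<close> and
  \<open>[0,1]\<close>. On each of its three pieces \<open>x0\<close> preserves standardness of intervals.
\<close>

lemma x0_standard_pieces:
  assumes std: "standard_interval a b" and b: "b \<le> 1" and a: "a > 0 \<or> b \<le> 1/4"
  shows "standard_interval (x0 a) (x0 b) \<and> affine_piece x0 a b (x0 a) (x0 b)"
proof -
  obtain m k :: nat where mk: "a = real m / 2 ^ k" "b = (real m + 1) / 2 ^ k"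
    using std unfolding standard_interval_def by blast
  have a0: "0 \<le> a" using mk by simp
  have ab: "a < b" using standard_interval_less[OF std] .
  consider "b \<le> 1/4" | "1/4 \<le> a" "b \<le> 1/2" | "1/2 \<le> a"
  proof -
    assume that: "b \<le> 1/4 \<Longrightarrow> thesis" "1/4 \<le> a \<Longrightarrow> b \<le> 1/2 \<Longrightarrow> thesis" "1/2 \<le> a \<Longrightarrow> thesis"
    show thesis
    proof (cases "b \<le> 1/4")
      case False
      then have m: "m \<ge> 1" using a mk by (cases m) auto
      have m1: "real m + 1 = real (m + 1)" by simp
      have "real m + 1 \<le> 2 ^ k" using b mk by (simp add: divide_simps)
      then have mk2: "m + 1 \<le> 2 ^ k"
        unfolding m1 of_nat_le_numeral_power_cancel_iff .
      have k0: "k \<noteq> 0" using m mk2 by (cases k) auto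
      show thesis
      proof (cases "k = 1")
        case True
        then have "m = 1" using m mk2 by simp
        then show thesis using that(3) mk True by simp
      next
        case k1: False
        obtain j where j: "k = Suc (Suc j)" using k0 k1 by (cases k; cases "k - 1") auto
        have "real m + 1 > 2 ^ j" using False mk unfolding j by (simp add: field_simps)
        then have "m + 1 > 2 ^ j" unfolding m1 numeral_power_less_of_nat_cancel_iff .
        then have "m \<ge> 2 ^ j" by simp
        then have "real m \<ge> 2 ^ j" unfolding numeral_power_le_of_nat_cancel_iff .
        then have a4: "1/4 \<le> a" unfolding mk j by (simp add: field_simps)
        show thesis
        proof (cases "b \<le> 1/2")
          case True then show thesis using that(2) a4 by simp
        next
          case False
          then have "real m + 1 > 2 ^ Suc j" using mk unfolding j by (simp add: field_simps)
          then have "m + 1 > 2 ^ Suc j" unfolding m1 numeral_power_less_of_nat_cancel_iff .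
          then have "m \<ge> 2 ^ Suc j" by simp
          then have "real m \<ge> 2 ^ Suc j" unfolding numeral_power_le_of_nat_cancel_iff .
          then have "1/2 \<le> a" unfolding mk j by (simp add: field_simps)
          then show thesis using that(3) by simp
        qed
      qed
    qed (use that in auto)
  qed
  then show ?thesis
  proof cases
    case 1
    have x: "x0 x = 2 * x" if "a \<le> x" "x \<le> b" for x using that 1 a0 by (simp add: x0_def)
    obtain j where "k = Suc j" using 1 mk by (cases k) auto
    then have "standard_interval (2 * a) (2 * b)"
      using mk by (intro standard_intervalI[of _ m j]) (auto simp: field_simps)
    moreover have "affine_piece x0 a b (x0 a) (x0 b)"
      using x by (intro affine_pieceI[OF ab, of _ 2 0]) simp
    ultimately show ?thesis using x[of a] x[of b] ab by simp
  next
    case 2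
    have x: "x0 x = x + 1/4" if "a \<le> x" "x \<le> b" for x using that 2 by (auto simp: x0_def)
    have "1 / 2 ^ k = b - a" unfolding mk by (simp add: add_divide_distrib)
    then have "1 / 2 ^ k \<le> (1/4 :: real)" using 2 by linarith
    then have k4: "(4::real) \<le> 2 ^ k" by (simp add: field_simps)
    have "k \<noteq> 0" using k4 by (intro notI) simp
    moreover have "k \<noteq> 1" using k4 by (intro notI) simp
    ultimately obtain j where j: "k = Suc (Suc j)" by (cases k; cases "k - 1") auto
    have "standard_interval (a + 1/4) (b + 1/4)"
      using mk unfolding j
      by (intro standard_intervalI[of _ "m + 2 ^ j" "Suc (Suc j)"]) (auto simp: field_simps)
    moreover have "affine_piece x0 a b (x0 a) (x0 b)"
      using x by (intro affine_pieceI[OF ab, of _ 1 "1/4"]) simp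
    ultimately show ?thesis using x[of a] x[of b] ab by simp
  next
    case 3
    have x: "x0 x = (1 + x) / 2" if "a \<le> x" "x \<le> b" for x using that 3 b by (auto simp: x0_def)
    have "affine_piece x0 a b (x0 a) (x0 b)"
      using x by (intro affine_pieceI[OF ab, of _ "1/2" "1/2"]) (simp add: add_divide_distrib)
    moreover have "x0 a = (1 + a) / 2" "x0 b = (1 + b) / 2" using x ab by auto
    ultimately show ?thesis using standard_interval_right_half[OF std] by (simp only:)
  qed
qed

text \<open>
  If the first piece is \<open>[0,2^-k]\<close> with \<open>k > 1\<close>, then no piece is cut by a breakpoint of \<open>x0\<close>, and \<open>x0\<close>
  doubles the first piece. After \<open>k - 1\<close> applications it is \<open>[0,1/2]\<close>. The case \<open>k = 0\<close> is excluded by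
  \<open>n \<ge> 2\<close>.
\<close>

lemma subdivision_normalise:
  assumes p: "subdivision n p" and n: "n \<ge> 2" and H: "subgroup H thompson_F" "x0 \<in> H"
  shows "\<exists>g p'. g \<in> H \<and> subdivision n p' \<and> p' 1 = 1/2 \<and> carries g n p p'"
proof -
  have "0 < n" using n by simp
  then have "standard_interval (p 0) (p (Suc 0))" "p 0 = 0" using p unfolding subdivision_def by blast+
  then have "p 0 = 0" "standard_interval (p 0) (p 1)" by simp_all
  then obtain k :: nat where "p 1 = 1 / 2 ^ k" using standard_interval_length by fastforce
  then show ?thesis using p
  proof (induction k arbitrary: p)
    case 0
    then show ?case using subdivision_mono[OF 0(2), of 2 n] subdivision_Suc_less[OF 0(2), of 1] n
      by (auto simp: subdivision_def numeral_2_eq_2)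
  next
    case (Suc k)
    show ?case
    proof (cases k)
      case 0
      have "carries \<one>\<^bsub>thompson_F\<^esub> n p p"
        unfolding carries_def affine_piece_def
      proof (intro allI impI ballI)
        fix i and s :: real assume i: "i < n" and s: "s \<in> {0..1}"
        show "\<one>\<^bsub>thompson_F\<^esub> (p i + s * (p (Suc i) - p i)) = p i + s * (p (Suc i) - p i)"
          by (intro F_one_apply subdivision_point_in[OF \<open>subdivision n p\<close> i s])
      qed
      then show ?thesis using Suc 0 subgroup.one_closed[OF H(1)] by auto
    next
      case (Suc j)
      have p0: "p 0 = 0" "p n = 1" using \<open>subdivision n p\<close> unfolding subdivision_def by auto
      have p1: "p 1 = 1 / 2 ^ Suc (Suc j)" using Suc.prems Suc by simp
      have p1': "0 < p 1" "p 1 \<le> 1/4" unfolding p1 by (simp_all add: field_simps)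
      have pieces: "standard_interval (x0 (p i)) (x0 (p (Suc i))) \<and>
          affine_piece x0 (p i) (p (Suc i)) (x0 (p i)) (x0 (p (Suc i)))" if i: "i < n" for i
      proof (rule x0_standard_pieces)
        show "standard_interval (p i) (p (Suc i))" using \<open>subdivision n p\<close> i unfolding subdivision_def by simp
        show "p (Suc i) \<le> 1" using subdivision_in[OF \<open>subdivision n p\<close>, of "Suc i"] i by simp
        show "p i > 0 \<or> p (Suc i) \<le> 1/4"
          using p1' subdivision_mono[OF \<open>subdivision n p\<close>, of 1 i] i by (cases i) auto
      qed
      have sub: "subdivision n (x0 \<circ> p)"
        unfolding subdivision_def using pieces p0 by (simp add: x0_def)
      have car: "carries x0 n p (x0 \<circ> p)" unfolding carries_def using pieces by simp
      have "x0 (p 1) = 2 * p 1" using p1' by (simp add: x0_def)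
      then have "(x0 \<circ> p) 1 = 1 / 2 ^ k" using p1 Suc by simp
      then obtain g p' where g: "g \<in> H" "subdivision n p'" "p' 1 = 1/2" "carries g n (x0 \<circ> p) p'"
        using Suc.IH[OF _ sub] by blast
      have "carries (g \<otimes>\<^bsub>thompson_F\<^esub> x0) n p p'"
        using carries_compose[OF x0_carrier _ \<open>subdivision n p\<close> car g(4)] g(1) subgroup.subset[OF H(1)] by blast
      then show ?thesis using g H subgroup.m_closed by metis
    qed
  qed
qed

lemma standard_interval_double:
  assumes "standard_interval a b" "1/2 \<le> a" "b \<le> 1"
  shows "standard_interval (2 * a - 1) (2 * b - 1)"
proof -
  obtain m k :: nat where mk: "a = real m / 2 ^ k" "b = (real m + 1) / 2 ^ k"
    using assms unfolding standard_interval_def by blast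
  have "k \<noteq> 0" using assms mk by (cases k; cases m) auto
  then obtain j where j: "k = Suc j" by (cases k) auto
  have "2 ^ j \<le> real m" using assms mk unfolding j by (simp add: field_simps)
  then have "2 ^ j \<le> m" unfolding numeral_power_le_of_nat_cancel_iff .
  then have "real (m - 2 ^ j) = real m - 2 ^ j" by (simp add: of_nat_diff)
  then show ?thesis
    using mk unfolding j by (intro standard_intervalI[of _ "m - 2 ^ j" j]) (auto simp: field_simps)
qed

text \<open>
  Induction on the number of pieces. Normalising both subdivisions gives an element \<open>f'\<close> that is the
  identity on \<open>[0,1/2]\<close>; it is the rescaled copy of an element \<open>f''\<close> with one piece less.
\<close>

lemma generated_by_x0_rscale:
  assumes H: "subgroup H thompson_F" and x0H: "x0 \<in> H"
    and rH: "\<And>f. f \<in> H \<Longrightarrow> rscale f \<in> H"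
    and f: "f \<in> carrier thompson_F" and p: "subdivision n p" and q: "subdivision n q"
    and car: "carries f n p q"
  shows "f \<in> H"
  using f p q car
proof (induction n arbitrary: f p q)
  case 0
  then show ?case using subdivision_pos by blast
next
  case (Suc n)
  show ?case
  proof (cases "n = 0")
    case True
    have "f = \<one>\<^bsub>thompson_F\<^esub>"
    proof (rule F_eqI)
      fix x :: real assume x: "x \<in> {0..1}"
      have "affine_piece f 0 1 0 1"
        using Suc.prems True unfolding carries_def subdivision_def by auto
      then show "f x = \<one>\<^bsub>thompson_F\<^esub> x"
        using x unfolding affine_piece_def by (simp add: F_one_apply)
    qed (use Suc.prems in auto)
    then show ?thesis using subgroup.one_closed[OF H] by simp
  next
    case False
    let ?n = "Suc n"
    have n2: "?n \<ge> 2" using False by simp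
    obtain g p' where g: "g \<in> H" "subdivision ?n p'" "p' 1 = 1/2" "carries g ?n p p'"
      using subdivision_normalise[OF Suc.prems(2) n2 H x0H] by blast
    obtain h q' where h: "h \<in> H" "subdivision ?n q'" "q' 1 = 1/2" "carries h ?n q q'"
      using subdivision_normalise[OF Suc.prems(3) n2 H x0H] by blast
    have gc: "g \<in> carrier thompson_F" and hc: "h \<in> carrier thompson_F"
      using g h subgroup.subset[OF H] by auto
    note fc = Suc.prems(1)
    define f' where "f' = h \<otimes>\<^bsub>thompson_F\<^esub> (f \<otimes>\<^bsub>thompson_F\<^esub> inv\<^bsub>thompson_F\<^esub> g)"
    have f'c: "f' \<in> carrier thompson_F" unfolding f'_def using gc hc fc by simp
    have "carries (f \<otimes>\<^bsub>thompson_F\<^esub> inv\<^bsub>thompson_F\<^esub> g) ?n p' q"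
      using carries_compose[OF _ fc g(2) carries_inv[OF gc Suc.prems(2) g(4)] Suc.prems(4)] gc by simp
    then have f'car: "carries f' ?n p' q'"
      unfolding f'_def using carries_compose[OF _ hc g(2) _ h(4)] fc gc by simp
    have low: "f' x = x" if "0 \<le> x" "x \<le> 1/2" for x
    proof -
      have "affine_piece f' (p' 0) (p' 1) (q' 0) (q' 1)" using f'car unfolding carries_def by simp
      moreover have "p' 0 = 0" "q' 0 = 0" using g h unfolding subdivision_def by auto
      ultimately have "affine_piece f' 0 (1/2) 0 (1/2)" by (simp only: g(3) h(3))
      then show ?thesis using affine_pieceD[of f' 0 "1/2" 0 "1/2" x] that by simp
    qed
    define f'' where "f'' = (\<lambda>x\<in>{0..1::real}. 2 * f' ((1 + x) / 2) - 1)"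
    have right: "subdivision n (\<lambda>i. 2 * r (Suc i) - 1)"
      if r: "subdivision ?n r" "r 1 = 1/2" for r
      unfolding subdivision_def
    proof (intro conjI allI impI)
      fix i assume i: "i < n"
      have "1/2 \<le> r (Suc i)" using subdivision_mono[OF r(1), of 1 "Suc i"] r i by simp
      moreover have "r (Suc (Suc i)) \<le> 1" using subdivision_in[OF r(1), of "Suc (Suc i)"] i by simp
      moreover have "standard_interval (r (Suc i)) (r (Suc (Suc i)))"
        using r(1) i unfolding subdivision_def by simp
      ultimately show "standard_interval (2 * r (Suc i) - 1) (2 * r (Suc (Suc i)) - 1)"
        using standard_interval_double by blast
    qed (use r in \<open>auto simp: subdivision_def\<close>)
    have f''car: "carries f'' n (\<lambda>i. 2 * p' (Suc i) - 1) (\<lambda>i. 2 * q' (Suc i) - 1)"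
      unfolding carries_def affine_piece_def
    proof (intro allI impI ballI)
      fix i and s :: real assume i: "i < n" and s: "s \<in> {0..1}"
      define x where "x = p' (Suc i) + s * (p' (Suc (Suc i)) - p' (Suc i))"
      have fx: "f' x = q' (Suc i) + s * (q' (Suc (Suc i)) - q' (Suc i))"
        using f'car i s unfolding carries_def affine_piece_def x_def by simp
      have "Suc i < Suc n" using i by simp
      then have "x \<in> {p' (Suc i)..p' (Suc (Suc i))}" "x \<in> {0..1}"
        unfolding x_def using subdivision_point_in[OF g(2) _ s] by blast+
      then have x: "1/2 \<le> x" "x \<le> 1"
        using subdivision_mono[OF g(2), of 1 "Suc i"] g i by auto
      have "2 * p' (Suc i) - 1 + s * (2 * p' (Suc (Suc i)) - 1 - (2 * p' (Suc i) - 1)) = 2 * x - 1"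
        unfolding x_def by (simp add: algebra_simps)
      moreover have "f'' (2 * x - 1) = 2 * f' x - 1" using x by (simp add: f''_def)
      ultimately show "f'' (2 * p' (Suc i) - 1 + s * (2 * p' (Suc (Suc i)) - 1 - (2 * p' (Suc i) - 1)))
        = 2 * q' (Suc i) - 1 + s * (2 * q' (Suc (Suc i)) - 1 - (2 * q' (Suc i) - 1))"
        unfolding fx by (simp add: algebra_simps)
    qed
    note rp = right[OF g(2,3)] and rq = right[OF h(2,3)]
    have f''c: "f'' \<in> carrier thompson_F"
      by (rule carries_imp_carrier[OF _ rp rq f''car]) (simp add: f''_def)
    have "f'' \<in> H" using Suc.IH[OF f''c rp rq f''car] .
    moreover have "rscale f'' = f'"
    proof (rule F_eqI)
      fix x :: real assume x: "x \<in> {0..1}"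
      show "rscale f'' x = f' x"
      proof (cases "x \<le> 1/2")
        case True then show ?thesis using low x by (simp add: rscale_low)
      next
        case False then show ?thesis using x by (simp add: rscale_high f''_def)
      qed
    qed (use f'c f''c rscale_carrier in auto)
    ultimately have "f' \<in> H" using rH by metis
    moreover have "f = inv\<^bsub>thompson_F\<^esub> h \<otimes>\<^bsub>thompson_F\<^esub> f' \<otimes>\<^bsub>thompson_F\<^esub> g"
      unfolding f'_def using gc hc fc by (simp add: F.m_assoc[symmetric]) (simp add: F.m_assoc)
    ultimately show ?thesis using H g h subgroup.m_closed subgroup.m_inv_closed by metis
  qed
qed

theorem thompson_F_generated: "generate thompson_F {x0, rscale x0} = carrier thompson_F"
proof (intro equalityI subsetI)
  have sub: "{x0, rscale x0} \<subseteq> carrier thompson_F" using x0_carrier rscale_carrier by blast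
  fix f
  show "f \<in> carrier thompson_F" if "f \<in> generate thompson_F {x0, rscale x0}"
    using F.generate_incl[OF sub] that by blast
  show "f \<in> generate thompson_F {x0, rscale x0}" if f: "f \<in> carrier thompson_F"
  proof -
    obtain n p q where pq: "subdivision n p" "subdivision n q" "carries f n p q"
      using carrier_imp_carries[OF f] by blast
    show ?thesis
    proof (rule generated_by_x0_rscale[OF _ _ _ f pq])
      show "subgroup (generate thompson_F {x0, rscale x0}) thompson_F"
        by (rule F.generate_is_subgroup[OF sub])
      show "x0 \<in> generate thompson_F {x0, rscale x0}" by (auto intro: generate.incl)
    qed (rule rscale_generate)
  qed
qed

section \<open>Finite differences\<close>

text \<open>
  Elements of the base group of the wreath product are encoded by their exponent functions on the
  integers. On these, multiplication by \<open>1 - t^n\<close> is the difference operator \<open>diff_op n\<close>.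
\<close>

definition diff_op :: "nat \<Rightarrow> (int \<Rightarrow> int) \<Rightarrow> int \<Rightarrow> int"
  where "diff_op n g = (\<lambda>i. g i - g (i - int n))"

definition unit_fun :: "int \<Rightarrow> int"
  where "unit_fun = (\<lambda>i. if i = 0 then 1 else 0)"

definition supp :: "(int \<Rightarrow> int) \<Rightarrow> int set"
  where "supp g = {i. g i \<noteq> 0}"

text \<open>
  It is meaningful only when \<open>supp g\<close> is finite, and \<open>0\<close> otherwise.
\<close>

definition pairing :: "(int \<Rightarrow> int) \<Rightarrow> (int \<Rightarrow> real) \<Rightarrow> real"
  where "pairing g P = (\<Sum>i\<in>supp g. of_int (g i) * P i)"

lemma pairing_eq_sum:
  assumes "finite A" "supp g \<subseteq> A"
  shows "pairing g P = (\<Sum>i\<in>A. of_int (g i) * P i)"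
  unfolding pairing_def by (rule sum.mono_neutral_left) (use assms in \<open>auto simp: supp_def\<close>)

lemma supp_add: "supp (\<lambda>i. g i + h i) \<subseteq> supp g \<union> supp h"
  by (auto simp: supp_def)

lemma supp_uminus: "supp (\<lambda>i. - g i) = supp g"
  by (auto simp: supp_def)

lemma supp_shift: "supp (\<lambda>i. g (i - e)) = (\<lambda>i. i + e) ` supp g"
proof (intro equalityI subsetI)
  fix i assume "i \<in> supp (\<lambda>i. g (i - e))"
  then have "i - e \<in> supp g" by (simp add: supp_def)
  then show "i \<in> (\<lambda>i. i + e) ` supp g" by (intro image_eqI[of _ _ "i - e"]) auto
qed (auto simp: supp_def)

lemma pairing_add:
  assumes "finite (supp g)" "finite (supp h)"
  shows "pairing (\<lambda>i. g i + h i) P = pairing g P + pairing h P"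
proof -
  let ?A = "supp g \<union> supp h"
  have A: "finite ?A" using assms by simp
  show ?thesis
    using pairing_eq_sum[OF A, of "\<lambda>i. g i + h i" P] pairing_eq_sum[OF A, of g P]
      pairing_eq_sum[OF A, of h P] supp_add[of g h]
    by (simp add: sum.distrib[symmetric] distrib_right)
qed

lemma pairing_uminus: "pairing (\<lambda>i. - g i) P = - pairing g P"
  by (simp add: pairing_def supp_uminus sum_negf)

lemma pairing_shift: "pairing (\<lambda>i. g (i - e)) P = pairing g (\<lambda>i. P (i + e))"
  unfolding pairing_def supp_shift by (subst sum.reindex) (auto simp: inj_on_def)

lemma pairing_right_diff: "pairing g (\<lambda>i. P i - Q i) = pairing g P - pairing g Q"
  by (simp add: pairing_def right_diff_distrib sum_subtractf)

lemma pairing_right_sum: "pairing g (\<lambda>i. \<Sum>j\<in>S. Q j i) = (\<Sum>j\<in>S. pairing g (Q j))"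
  unfolding pairing_def sum_distrib_left by (rule sum.swap)

lemma finite_supp_diff_op: "finite (supp g) \<Longrightarrow> finite (supp (diff_op n g))"
  using finite_subset[OF supp_add[of g "\<lambda>i. - g (i - int n)"]]
  by (simp add: diff_op_def supp_uminus supp_shift)

lemma finite_supp_funpow: "finite (supp ((diff_op n ^^ m) unit_fun))"
proof (induction m)
  case 0
  have "supp unit_fun \<subseteq> {0}" by (auto simp: supp_def unit_fun_def)
  then show ?case by (simp add: finite_subset)
qed (simp add: finite_supp_diff_op)

lemma pairing_diff_op:
  assumes "finite (supp g)"
  shows "pairing (diff_op n g) P = pairing g (\<lambda>i. P i - P (i + int n))"
proof -
  have "pairing (diff_op n g) P = pairing (\<lambda>i. g i + - g (i - int n)) P"
    by (simp add: diff_op_def)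
  also have "\<dots> = pairing g P + - pairing g (\<lambda>i. P (i + int n))"
    using assms pairing_shift[of g "int n" P]
    by (subst pairing_add) (auto simp: supp_uminus supp_shift pairing_uminus)
  finally show ?thesis by (simp add: pairing_right_diff)
qed

text \<open>
  Summing Pascal's rule: a difference with step \<open>n\<close> is a sum of \<open>n\<close> differences with step \<open>1\<close>.
\<close>

lemma gbinomial_telescope:
  "(x + real n gchoose Suc m) - (x gchoose Suc m) = (\<Sum>j<n. x + real j gchoose m)"
proof (induction n)
  case (Suc n)
  have "(x + real n + 1 gchoose Suc m) = (x + real n gchoose m) + (x + real n gchoose Suc m)"
    by (rule gbinomial_Suc_Suc)
  then show ?case using Suc by (simp add: algebra_simps)
qed simp

text \<open>
  By duality each difference operator moves to the binomial polynomial, lowers its degree by one, and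
  produces a sum of \<open>n\<close> translates. After \<open>m\<close> steps \<open>n ^ m\<close> copies of the constant \<open>1\<close> remain, up to
  sign. The value is independent of the translation \<open>s\<close>; this is what makes the functional useful for words, in which
  the letters \<open>x0\<close> translate the exponent functions.
\<close>

lemma pairing_diff_op_gbinomial:
  "pairing ((diff_op n ^^ m) unit_fun) (\<lambda>i. of_int (i + s) gchoose m) = (- real n) ^ m"
proof (induction m arbitrary: s)
  case 0
  have "supp unit_fun = {0}" by (auto simp: supp_def unit_fun_def)
  then show ?case by (simp add: pairing_def unit_fun_def)
next
  case (Suc m)
  let ?g = "(diff_op n ^^ m) unit_fun"
  have "(of_int (i + s) gchoose Suc m) - (of_int (i + int n + s) gchoose Suc m)
      = - (\<Sum>j<n. (of_int (i + (s + int j)) :: real) gchoose m)" for i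
    using gbinomial_telescope[of "of_int (i + s)" n m] by (simp add: algebra_simps)
  then have "pairing (diff_op n ?g) (\<lambda>i. of_int (i + s) gchoose Suc m)
      = pairing ?g (\<lambda>i. 0 - (\<Sum>j<n. of_int (i + (s + int j)) gchoose m))"
    using finite_supp_funpow by (subst pairing_diff_op) auto
  also have "\<dots> = - (\<Sum>j<n. pairing ?g (\<lambda>i. of_int (i + (s + int j)) gchoose m))"
    unfolding pairing_right_diff pairing_right_sum by (simp add: pairing_def)
  also have "\<dots> = - (\<Sum>j<n. (- real n) ^ m)"
    by (intro arg_cong[where f = uminus] sum.cong refl) (rule Suc)
  also have "\<dots> = (- real n) ^ Suc m" by simp
  finally show ?case by simp
qed

section \<open>A copy of the wreath product of two infinite cyclic groups\<close>

text \<open>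
  An element of \<open>F\<close> supported in \<open>[1/2,3/4]\<close>. This interval is a fundamental domain for \<open>x0\<close>, which maps
  its left end to its right end.
\<close>

definition bump :: "real \<Rightarrow> real"
  where "bump = (\<lambda>x\<in>{0..1}. if x \<le> 1/2 then x else if x \<le> 9/16 then 2 * x - 1/2
    else if x \<le> 5/8 then x + 1/16 else if x \<le> 3/4 then x / 2 + 3/8 else x)"

lemma bump_carrier: "bump \<in> carrier thompson_F"
proof (rule carries_imp_carrier)
  let ?p = "(!) [0, 1/2, 9/16, 5/8, 3/4, 1 :: real]" and ?q = "(!) [0, 1/2, 5/8, 11/16, 3/4, 1 :: real]"
  show "bump \<in> extensional {0..1}" by (simp add: bump_def)
  have less_5: "i < 5 \<longleftrightarrow> i = 0 \<or> i = 1 \<or> i = 2 \<or> i = 3 \<or> i = 4" for i :: nat by auto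
  show "subdivision 5 ?p"
    unfolding subdivision_def less_5
    using standard_intervalI[of 0 0 1 "1/2"] standard_intervalI[of "1/2" 8 4 "9/16"]
      standard_intervalI[of "9/16" 9 4 "5/8"] standard_intervalI[of "5/8" 5 3 "3/4"]
      standard_intervalI[of "3/4" 3 2 1] by (auto simp: numeral_eq_Suc)
  show "subdivision 5 ?q"
    unfolding subdivision_def less_5
    using standard_intervalI[of 0 0 1 "1/2"] standard_intervalI[of "1/2" 4 3 "5/8"]
      standard_intervalI[of "5/8" 10 4 "11/16"] standard_intervalI[of "11/16" 11 4 "3/4"]
      standard_intervalI[of "3/4" 3 2 1] by (auto simp: numeral_eq_Suc)
  show "carries bump 5 ?p ?q"
    unfolding carries_def less_5 affine_piece_def bump_def
    by (auto simp: numeral_eq_Suc field_simps)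
qed

text \<open>
  The interior of the fundamental domain that contains the support of \<open>bump\<close>.
\<close>

abbreviation J :: "real set" where "J \<equiv> {1/2<..<3/4}"

lemma F_int_pow_fixed:
  assumes f: "f \<in> carrier thompson_F" and x: "x \<in> {0..1}" "f x = x"
  shows "(f [^]\<^bsub>thompson_F\<^esub> (k::int)) x = x"
proof -
  let ?S = "{h \<in> carrier thompson_F. h x = x}"
  have "subgroup ?S thompson_F"
  proof (rule F.subgroupI)
    show "?S \<noteq> {}" using F_one_apply[OF x(1)] by blast
    show "inv\<^bsub>thompson_F\<^esub> h \<in> ?S" if "h \<in> ?S" for h using that F_inv_apply(1)[of h x] x by simp
  qed (use x in \<open>auto simp: F_mult_apply\<close>)
  then have "f [^]\<^bsub>thompson_F\<^esub> k \<in> ?S" using F.subgroup_int_pow_closed f x by blast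
  then show ?thesis by blast
qed

lemma F_int_pow_apply_add:
  assumes f: "f \<in> carrier thompson_F" and x: "x \<in> {0..1}"
  shows "(f [^]\<^bsub>thompson_F\<^esub> (i + j :: int)) x = (f [^]\<^bsub>thompson_F\<^esub> i) ((f [^]\<^bsub>thompson_F\<^esub> j) x)"
  using f x by (simp add: F.int_pow_mult F_mult_apply)

lemma bump_fixed: "x \<in> {0..1} \<Longrightarrow> x \<notin> J \<Longrightarrow> bump x = x"
  by (auto simp: bump_def)

lemma fixes_outside_J_imp_maps_J:
  assumes f: "f \<in> carrier thompson_F" and half: "f (1/2) = 1/2" "f (3/4) = 3/4" and x: "x \<in> J"
  shows "f x \<in> J"
  using strict_mono_onD[OF F_strict_mono[OF f], of "1/2" x]
    strict_mono_onD[OF F_strict_mono[OF f], of x "3/4"] half x by auto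

lemma bump_pow_J: "x \<in> J \<Longrightarrow> (bump [^]\<^bsub>thompson_F\<^esub> (k::int)) x \<in> J"
  using F_int_pow_fixed[OF bump_carrier, of "1/2" k] F_int_pow_fixed[OF bump_carrier, of "3/4" k]
  by (intro fixes_outside_J_imp_maps_J[of "bump [^]\<^bsub>thompson_F\<^esub> k"])
    (simp_all add: bump_carrier bump_fixed)

lemma x0_high: "y \<in> {1/2..1} \<Longrightarrow> x0 y \<in> {3/4..1}"
  by (auto simp: x0_def)

text \<open>
  Positive powers of \<open>x0\<close> move \<open>J\<close> into \<open>[3/4,1]\<close>; negative powers reduce to this case by exchanging a point
  with its image.
\<close>

lemma x0_pow_J_disjoint:
  assumes x: "x \<in> J" and i: "(x0 [^]\<^bsub>thompson_F\<^esub> (i::int)) x \<in> J"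
  shows "i = 0"
proof -
  have pos: "(x0 [^]\<^bsub>thompson_F\<^esub> (int (Suc n))) y \<in> {3/4..1}" if y: "y \<in> J" for n y
  proof (induction n)
    case 0
    have "x0 [^]\<^bsub>thompson_F\<^esub> (int (Suc 0)) = x0" using x0_carrier by simp
    moreover have "x0 y \<in> {3/4..1}" using y by (auto simp: x0_def)
    ultimately show ?case by (simp only:)
  next
    case (Suc n)
    let ?z = "(x0 [^]\<^bsub>thompson_F\<^esub> (int (Suc n))) y"
    have "int (Suc (Suc n)) = 1 + int (Suc n)" by simp
    then have "(x0 [^]\<^bsub>thompson_F\<^esub> (int (Suc (Suc n)))) y = x0 ?z"
      using F_int_pow_apply_add[OF x0_carrier, of y 1 "int (Suc n)"] y x0_carrier by (simp only: F.int_pow_1) simp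
    then show ?case using Suc x0_high[of ?z] by simp
  qed
  show ?thesis
  proof (rule ccontr)
    assume "i \<noteq> 0"
    then consider n where "i = int (Suc n)" | n where "i = - int (Suc n)"
      by (metis int_cases int_cases4 nat.exhaust of_nat_0 neg_equal_0_iff_equal)
    then show False
    proof cases
      case 1 then show False using pos[OF x, of n] i by auto
    next
      case 2
      let ?y = "(x0 [^]\<^bsub>thompson_F\<^esub> i) x"
      have "(x0 [^]\<^bsub>thompson_F\<^esub> (int (Suc n))) ?y = x"
        using F_int_pow_apply_add[OF x0_carrier, of x "int (Suc n)" i] x 2 by (simp add: F_one_apply)
      then show False using pos[OF i, of n] x by auto
    qed
  qed
qed

text \<open>
  The orbit of \<open>9/16\<close> under \<open>bump\<close> and \<open>x0\<close>, indexed by the fundamental domain \<open>i\<close> and the position \<open>k\<close> inside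
  it. The point \<open>9/16\<close> is one that \<open>bump\<close> moves.
\<close>

definition pt :: "int \<Rightarrow> int \<Rightarrow> real"
  where "pt i k = (x0 [^]\<^bsub>thompson_F\<^esub> i) ((bump [^]\<^bsub>thompson_F\<^esub> k) (9/16))"

lemma bump_orbit_J: "(bump [^]\<^bsub>thompson_F\<^esub> (k::int)) (9/16) \<in> J"
  by (rule bump_pow_J) simp

lemma bump_pow_moves:
  assumes "(bump [^]\<^bsub>thompson_F\<^esub> (k::int)) (9/16) = 9/16"
  shows "k = 0"
proof -
  note b = bump_carrier
  have up: "(bump [^]\<^bsub>thompson_F\<^esub> (int (Suc n))) (9/16) > 9/16" for n
  proof (induction n)
    case 0
    have "bump [^]\<^bsub>thompson_F\<^esub> (int (Suc 0)) = bump" using b by simp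
    moreover have "bump (9/16) > 9/16" by (simp add: bump_def)
    ultimately show ?case by (simp only:)
  next
    case (Suc n)
    let ?z = "(bump [^]\<^bsub>thompson_F\<^esub> (int (Suc n))) (9/16)"
    have "int (Suc (Suc n)) = 1 + int (Suc n)" by simp
    then have "(bump [^]\<^bsub>thompson_F\<^esub> (int (Suc (Suc n)))) (9/16) = bump ?z"
      using F_int_pow_apply_add[OF b, of "9/16" 1 "int (Suc n)"] b by (simp only: F.int_pow_1) simp
    moreover have "bump (9/16) < bump ?z"
      using Suc bump_orbit_J[of "int (Suc n)"] by (intro strict_mono_onD[OF F_strict_mono[OF b]]) auto
    moreover have "bump (9/16) > 9/16" by (simp add: bump_def)
    ultimately show ?case by linarith
  qed
  show ?thesis
  proof (rule ccontr)
    assume "k \<noteq> 0"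
    then consider n where "k = int (Suc n)" | n where "k = - int (Suc n)"
      by (metis int_cases int_cases4 nat.exhaust of_nat_0 neg_equal_0_iff_equal)
    then show False
    proof cases
      case 1 then show False using up[of n] assms by auto
    next
      case 2
      have "(bump [^]\<^bsub>thompson_F\<^esub> (int (Suc n))) ((bump [^]\<^bsub>thompson_F\<^esub> k) (9/16)) = 9/16"
        using F_int_pow_apply_add[OF b, of "9/16" "int (Suc n)" k] 2 by (simp add: F_one_apply)
      then show False using up[of n] assms by simp
    qed
  qed
qed

lemma pt_inject:
  assumes "pt i k = pt j l"
  shows "i = j \<and> k = l"
proof -
  let ?b = "\<lambda>k::int. (bump [^]\<^bsub>thompson_F\<^esub> k) (9/16)"
  have J: "?b k \<in> J" "?b l \<in> J" using bump_orbit_J by auto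
  then have I: "?b k \<in> {0..1}" "?b l \<in> {0..1}" by auto
  have "(x0 [^]\<^bsub>thompson_F\<^esub> (- j)) ((x0 [^]\<^bsub>thompson_F\<^esub> i) (?b k))
      = (x0 [^]\<^bsub>thompson_F\<^esub> (- j)) ((x0 [^]\<^bsub>thompson_F\<^esub> j) (?b l))"
    using assms unfolding pt_def by simp
  then have e: "(x0 [^]\<^bsub>thompson_F\<^esub> (- j + i)) (?b k) = ?b l"
    using F_int_pow_apply_add[OF x0_carrier I(1), of "- j" i]
      F_int_pow_apply_add[OF x0_carrier I(2), of "- j" j] I by (simp add: F_one_apply)
  then have ij: "i = j" using x0_pow_J_disjoint[OF J(1), of "- j + i"] J by simp
  then have "?b k = ?b l" using e I by (simp add: F_one_apply)
  then have "(bump [^]\<^bsub>thompson_F\<^esub> (- l)) (?b k) = (bump [^]\<^bsub>thompson_F\<^esub> (- l)) (?b l)" by simp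
  then have "(bump [^]\<^bsub>thompson_F\<^esub> (- l + k)) (9/16) = 9/16"
    using F_int_pow_apply_add[OF bump_carrier, of "9/16" "- l" k]
      F_int_pow_apply_add[OF bump_carrier, of "9/16" "- l" l] by (simp add: F_one_apply)
  then show ?thesis using bump_pow_moves ij by fastforce
qed

lemma pt_in: "pt i k \<in> {0..1}"
proof -
  have "(bump [^]\<^bsub>thompson_F\<^esub> k) (9/16) \<in> {0..1}" using bump_orbit_J[of k] by simp
  then show ?thesis unfolding pt_def by (rule F_maps[OF F.int_pow_closed[OF x0_carrier]])
qed

text \<open>
  In terms of the wreath product, \<open>h\<close> acts like the power \<open>e\<close> of \<open>x0\<close> applied after the element of the
  base group with exponent function \<open>g\<close>.
\<close>

definition acts :: "(real \<Rightarrow> real) \<Rightarrow> int \<Rightarrow> (int \<Rightarrow> int) \<Rightarrow> bool"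
  where "acts h e g \<longleftrightarrow> h \<in> carrier thompson_F \<and> (\<forall>i k. h (pt i k) = pt (i + e) (k + g i))"

text \<open>
  The points \<open>pt i k\<close> are distinct. Hence exponents may be read off from the element itself, whichever
  word it was obtained from.
\<close>

lemma acts_unique:
  assumes "acts h e g" "acts h e' g'"
  shows "e = e' \<and> g = g'"
proof -
  have "pt (i + e) (0 + g i) = pt (i + e') (0 + g' i)" for i
    using assms unfolding acts_def by metis
  then have "i + e = i + e' \<and> 0 + g i = 0 + g' i" for i by (rule pt_inject)
  then show ?thesis by auto
qed

lemma acts_mult:
  assumes "acts h e g" "acts h' e' g'"
  shows "acts (h \<otimes>\<^bsub>thompson_F\<^esub> h') (e + e') (\<lambda>i. g' i + g (i + e'))"
  using assms unfolding acts_def by (auto simp: F_mult_apply[OF _ _ pt_in] algebra_simps)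

lemma acts_one: "acts \<one>\<^bsub>thompson_F\<^esub> 0 (\<lambda>_. 0)"
  unfolding acts_def by (simp add: F_one_apply[OF pt_in])

lemma acts_inv:
  assumes "acts h e g"
  shows "acts (inv\<^bsub>thompson_F\<^esub> h) (- e) (\<lambda>i. - g (i - e))"
proof -
  have h: "h \<in> carrier thompson_F" and a: "h (pt (i - e) (k - g (i - e))) = pt i k" for i k
    using assms unfolding acts_def by auto
  have "(inv\<^bsub>thompson_F\<^esub> h) (pt i k) = pt (i - e) (k - g (i - e))" for i k
    using F_inv_apply(1)[OF h pt_in, of "i - e" "k - g (i - e)"] a by simp
  then show ?thesis unfolding acts_def using h by simp
qed

lemma acts_x0: "acts x0 1 (\<lambda>_. 0)"
proof -
  have "x0 (pt i k) = pt (i + 1) k" for i k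
  proof -
    have "(bump [^]\<^bsub>thompson_F\<^esub> k) (9/16) \<in> {0..1}" using bump_orbit_J[of k] by auto
    then show ?thesis
      using F_int_pow_apply_add[OF x0_carrier, of "(bump [^]\<^bsub>thompson_F\<^esub> k) (9/16)" 1 i] x0_carrier
      unfolding pt_def by (simp add: add.commute)
  qed
  then show ?thesis unfolding acts_def using x0_carrier by simp
qed

lemma acts_x0_pow: "acts (x0 [^]\<^bsub>thompson_F\<^esub> (n::nat)) (int n) (\<lambda>_. 0)"
proof (induction n)
  case 0 then show ?case using acts_one by simp
next
  case (Suc n)
  then show ?case using acts_mult[OF Suc acts_x0] by (simp add: add.commute)
qed

lemma acts_bump: "acts bump 0 unit_fun"
proof -
  have "bump (pt i k) = pt i (k + unit_fun i)" for i k
  proof (cases "i = 0")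
    case True
    have "pt 0 l = (bump [^]\<^bsub>thompson_F\<^esub> l) (9/16)" for l
      using bump_orbit_J[of l] by (simp add: pt_def F_one_apply)
    then show ?thesis
      using F_int_pow_apply_add[OF bump_carrier, of "9/16" 1 k] bump_carrier True
      by (simp add: unit_fun_def add.commute)
  next
    case False
    then have "pt i k \<notin> J" using x0_pow_J_disjoint bump_orbit_J unfolding pt_def by blast
    then show ?thesis using bump_fixed[OF pt_in] False by (simp add: unit_fun_def)
  qed
  then show ?thesis unfolding acts_def using bump_carrier by simp
qed

lemma acts_conj_diff:
  assumes "acts x 0 g"
  shows "acts (conj_diff thompson_F x0 n x) 0 (diff_op n g)"
proof -
  note t = acts_x0_pow[of n]
  have "acts (conj_diff thompson_F x0 n x) 0 (\<lambda>i. - g (i - int n) + g i)"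
    using acts_mult[OF assms acts_inv[OF acts_mult[OF acts_mult[OF t assms] acts_inv[OF t]]]]
    unfolding conj_diff_def by (simp add: add.commute)
  then show ?thesis by (simp add: diff_op_def)
qed

lemma acts_conj_diff_funpow:
  "acts ((conj_diff thompson_F x0 n ^^ m) bump) 0 ((diff_op n ^^ m) unit_fun)"
  by (induction m) (auto simp: acts_bump acts_conj_diff)

text \<open>
  Each letter changes the value of the functional \<open>g \<mapsto> pairing g P\<close>, with \<open>P\<close> a translate of the binomial
  polynomial of degree \<open>m\<close>, by at most \<open>1\<close>: the letters \<open>x0\<close> leave \<open>g\<close> unchanged, and the letters \<open>b\<close> add a
  translate of the \<open>m\<close>-th difference of the unit function up to sign, whose pairing with \<open>P\<close> is \<open>1\<close> up
  to sign. The bound is for all translates at once because a new letter is evaluated after a shift.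
\<close>

lemma word_acts:
  fixes m :: nat
  defines "b \<equiv> (conj_diff thompson_F x0 1 ^^ m) bump"
  assumes "set ws \<subseteq> {x0, b} \<union> m_inv thompson_F ` {x0, b}"
  shows "\<exists>e g. acts (foldr (mult thompson_F) ws \<one>\<^bsub>thompson_F\<^esub>) e g \<and> finite (supp g) \<and>
    (\<forall>s. \<bar>pairing g (\<lambda>i. of_int (i + s) gchoose m)\<bar> \<le> real (length ws))"
  using assms(2)
proof (induction ws)
  case Nil
  have "supp (\<lambda>_. 0) = {}" by (simp add: supp_def)
  then show ?case using acts_one by (intro exI[of _ 0] exI[of _ "\<lambda>_. 0"]) (simp add: pairing_def)
next
  case (Cons w ws)
  let ?c = "(diff_op 1 ^^ m) unit_fun"
  let ?P = "\<lambda>s i. of_int (i + s) gchoose m :: real"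
  have zero: "supp (\<lambda>_. 0) = {}" by (simp add: supp_def)
  have c: "pairing ?c (?P s) = (- 1) ^ m" for s
    using pairing_diff_op_gbinomial[where n = 1 and m = m and s = s] by simp
  have b: "acts b 0 ?c" unfolding b_def by (rule acts_conj_diff_funpow)
  have letter: "\<exists>e g. acts w e g \<and> finite (supp g) \<and> (\<forall>s. \<bar>pairing g (?P s)\<bar> \<le> 1)"
  proof -
    consider "w = x0" | "w = b" | "w = inv\<^bsub>thompson_F\<^esub> x0" | "w = inv\<^bsub>thompson_F\<^esub> b"
      using Cons.prems by auto
    then show ?thesis
    proof cases
      case 1
      then show ?thesis using acts_x0 zero
        by (intro exI[of _ 1] exI[of _ "\<lambda>_. 0"]) (simp add: pairing_def)
    next
      case 2
      then show ?thesis using b c finite_supp_funpow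
        by (intro exI[of _ 0] exI[of _ ?c]) (simp add: power_abs)
    next
      case 3
      then show ?thesis using acts_inv[OF acts_x0] zero
        by (intro exI[of _ "- 1"] exI[of _ "\<lambda>_. 0"]) (simp add: pairing_def)
    next
      case 4
      then show ?thesis using acts_inv[OF b] c finite_supp_funpow
        by (intro exI[of _ 0] exI[of _ "\<lambda>i. - ?c i"]) (simp add: power_abs pairing_uminus supp_uminus)
    qed
  qed
  then obtain e g where w: "acts w e g" "finite (supp g)" "\<And>s. \<bar>pairing g (?P s)\<bar> \<le> 1" by blast
  obtain e' g' where ws: "acts (foldr (mult thompson_F) ws \<one>\<^bsub>thompson_F\<^esub>) e' g'" "finite (supp g')"
    "\<And>s. \<bar>pairing g' (?P s)\<bar> \<le> real (length ws)"
    using Cons by auto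
  have sh: "pairing (\<lambda>i. g (i + e')) (?P s) = pairing g (?P (s - e'))" for s
    using pairing_shift[of g "- e'" "?P s"] by (simp add: algebra_simps)
  have fin: "finite (supp (\<lambda>i. g (i + e')))"
    using supp_shift[of g "- e'"] w(2) by simp
  have "\<bar>pairing (\<lambda>i. g' i + g (i + e')) (?P s)\<bar> \<le> real (length (w # ws))" for s
    unfolding pairing_add[OF ws(2) fin] sh using ws(3)[of s] w(3)[of "s - e'"] by simp
  moreover have "finite (supp (\<lambda>i. g' i + g (i + e')))"
    using finite_subset[OF supp_add] ws(2) fin by blast
  ultimately show ?case using acts_mult[OF w(1) ws(1)]
    by (intro exI[of _ "e + e'"] exI[of _ "\<lambda>i. g' i + g (i + e')"]) simp
qed

section \<open>Polynomial distortion\<close>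

text \<open>
  Two distinct conjugates have disjoint supports, each of which is preserved by its own conjugate.
\<close>

lemma conjugates_of_bump_commute:
  fixes i j :: int
  defines "c \<equiv> \<lambda>i::int. x0 [^]\<^bsub>thompson_F\<^esub> i \<otimes>\<^bsub>thompson_F\<^esub> bump \<otimes>\<^bsub>thompson_F\<^esub> inv\<^bsub>thompson_F\<^esub> (x0 [^]\<^bsub>thompson_F\<^esub> i)"
  shows "c i \<otimes>\<^bsub>thompson_F\<^esub> c j = c j \<otimes>\<^bsub>thompson_F\<^esub> c i"
proof (cases "i = j")
  case False
  note x = x0_carrier and b = bump_carrier
  have cc: "c i \<in> carrier thompson_F" for i unfolding c_def using x b by simp
  have c_apply: "c i y = (x0 [^]\<^bsub>thompson_F\<^esub> i) (bump ((x0 [^]\<^bsub>thompson_F\<^esub> (- i)) y))"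
    if "y \<in> {0..1}" for i y
  proof -
    let ?s = "x0 [^]\<^bsub>thompson_F\<^esub> i" and ?r = "x0 [^]\<^bsub>thompson_F\<^esub> (- i)"
    have s: "?s \<in> carrier thompson_F" "?r \<in> carrier thompson_F" using x by simp_all
    have "c i = ?s \<otimes>\<^bsub>thompson_F\<^esub> bump \<otimes>\<^bsub>thompson_F\<^esub> ?r"
      unfolding c_def using x by (simp add: F.int_pow_neg)
    then show ?thesis
      using F_mult_apply[OF F.m_closed[OF s(1) b] s(2) that]
        F_mult_apply[OF s(1) b F_maps[OF s(2) that]] by (simp only:)
  qed
  have cancel: "(x0 [^]\<^bsub>thompson_F\<^esub> i) ((x0 [^]\<^bsub>thompson_F\<^esub> (- i)) y) = y"
    "(x0 [^]\<^bsub>thompson_F\<^esub> (- i)) ((x0 [^]\<^bsub>thompson_F\<^esub> i) y) = y" if "y \<in> {0..1}" for i :: int and y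
    using that F_int_pow_apply_add[OF x that, of i "- i"] F_int_pow_apply_add[OF x that, of "- i" i]
    by (simp_all add: F_one_apply)
  have xI: "(x0 [^]\<^bsub>thompson_F\<^esub> k) y \<in> {0..1}" if "y \<in> {0..1}" for k :: int and y
    using that x F_maps by simp
  have fixed: "c i y = y" if "y \<in> {0..1}" "(x0 [^]\<^bsub>thompson_F\<^esub> (- i)) y \<notin> J" for i y
    using c_apply[OF that(1)] bump_fixed[OF xI[OF that(1)] that(2)] cancel[OF that(1)] by simp
  have stays: "(x0 [^]\<^bsub>thompson_F\<^esub> (- i)) (c i y) \<in> J"
    if "y \<in> {0..1}" "(x0 [^]\<^bsub>thompson_F\<^esub> (- i)) y \<in> J" for i y
  proof -
    have "bump ((x0 [^]\<^bsub>thompson_F\<^esub> (- i)) y) \<in> J"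
      using bump_pow_J[OF that(2), of 1] b by simp
    moreover from this have "bump ((x0 [^]\<^bsub>thompson_F\<^esub> (- i)) y) \<in> {0..1}" by auto
    ultimately show ?thesis using c_apply[OF that(1)] cancel by simp
  qed
  have disjoint: "(x0 [^]\<^bsub>thompson_F\<^esub> (- j)) y \<notin> J"
    if ij: "i \<noteq> j" and y: "y \<in> {0..1}" "(x0 [^]\<^bsub>thompson_F\<^esub> (- i)) y \<in> J" for i j :: int and y
  proof
    assume J: "(x0 [^]\<^bsub>thompson_F\<^esub> (- j)) y \<in> J"
    have "(x0 [^]\<^bsub>thompson_F\<^esub> (- j + i)) ((x0 [^]\<^bsub>thompson_F\<^esub> (- i)) y) = (x0 [^]\<^bsub>thompson_F\<^esub> (- j)) y"
      using F_int_pow_apply_add[OF x xI[OF y(1)], of "- j" i "- i"] cancel[OF y(1)] by simp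
    then have "- j + i = 0" using x0_pow_J_disjoint[OF y(2), of "- j + i"] J by simp
    then show False using ij by simp
  qed
  have half: "c i (c j y) = c j (c i y)"
    if ij: "i \<noteq> j" and y: "y \<in> {0..1}" "(x0 [^]\<^bsub>thompson_F\<^esub> (- i)) y \<in> J" for i j :: int and y
  proof -
    have "c i y \<in> {0..1}" using F_maps[OF cc y(1)] .
    then have "c j (c i y) = c i y" using fixed disjoint[OF ij _ stays[OF y]] by blast
    moreover have "c j y = y" using fixed[OF y(1)] disjoint[OF ij y] by blast
    ultimately show ?thesis by simp
  qed
  show ?thesis
  proof (rule F_eqI)
    fix y :: real assume y: "y \<in> {0..1}"
    have "c i (c j y) = c j (c i y)"
    proof (cases "(x0 [^]\<^bsub>thompson_F\<^esub> (- i)) y \<in> J")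
      case True then show ?thesis using half[OF False y] by blast
    next
      case i: False
      show ?thesis
      proof (cases "(x0 [^]\<^bsub>thompson_F\<^esub> (- j)) y \<in> J")
        case True then show ?thesis using half[OF False[symmetric] y] by simp
      next
        case False then show ?thesis using fixed[OF y] i by simp
      qed
    qed
    then show "(c i \<otimes>\<^bsub>thompson_F\<^esub> c j) y = (c j \<otimes>\<^bsub>thompson_F\<^esub> c i) y"
      using cc y by (simp add: F_mult_apply)
  qed (use cc in auto)
qed simp

definition base_group :: "(real \<Rightarrow> real) set"
  where "base_group = generate thompson_F
    (range (\<lambda>i::int. x0 [^]\<^bsub>thompson_F\<^esub> i \<otimes>\<^bsub>thompson_F\<^esub> bump \<otimes>\<^bsub>thompson_F\<^esub> inv\<^bsub>thompson_F\<^esub> (x0 [^]\<^bsub>thompson_F\<^esub> i)))"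

interpretation base: abelian_shift thompson_F base_group x0
proof (rule abelian_shift.intro[OF group_thompson_F abelian_shift_axioms.intro])
  let ?c = "\<lambda>i::int. x0 [^]\<^bsub>thompson_F\<^esub> i \<otimes>\<^bsub>thompson_F\<^esub> bump \<otimes>\<^bsub>thompson_F\<^esub> inv\<^bsub>thompson_F\<^esub> (x0 [^]\<^bsub>thompson_F\<^esub> i)"
  have sub: "range ?c \<subseteq> carrier thompson_F" using x0_carrier bump_carrier by auto
  show "subgroup base_group thompson_F" unfolding base_group_def by (rule F.generate_is_subgroup[OF sub])
  then interpret N: subgroup base_group thompson_F .
  show "x0 \<in> carrier thompson_F" by (rule x0_carrier)
  show "x \<otimes>\<^bsub>thompson_F\<^esub> y = y \<otimes>\<^bsub>thompson_F\<^esub> x" if "x \<in> base_group" "y \<in> base_group" for x y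
    using that unfolding base_group_def
    by (rule F.generate_commute[OF sub, rotated]) (use conjugates_of_bump_commute in blast)
    have step: "x0 \<otimes>\<^bsub>thompson_F\<^esub> h \<otimes>\<^bsub>thompson_F\<^esub> inv\<^bsub>thompson_F\<^esub> x0 \<in> base_group" if h: "h \<in> range ?c" for h
    proof -
      obtain i where i: "h = ?c i" using h by blast
      have "x0 \<otimes>\<^bsub>thompson_F\<^esub> x0 [^]\<^bsub>thompson_F\<^esub> i = x0 [^]\<^bsub>thompson_F\<^esub> (1 + i)"
        using x0_carrier by (simp add: F.int_pow_mult)
      then have "x0 \<otimes>\<^bsub>thompson_F\<^esub> h \<otimes>\<^bsub>thompson_F\<^esub> inv\<^bsub>thompson_F\<^esub> x0 = ?c (1 + i)"
        unfolding i using F.conj_conj[of x0 "x0 [^]\<^bsub>thompson_F\<^esub> i" bump] x0_carrier bump_carrier by simp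
      then show ?thesis unfolding base_group_def by (auto intro: generate.incl)
    qed
  show "x0 \<otimes>\<^bsub>thompson_F\<^esub> x \<otimes>\<^bsub>thompson_F\<^esub> inv\<^bsub>thompson_F\<^esub> x0 \<in> base_group" if "x \<in> base_group" for x
    using that[unfolded base_group_def]
  proof (induction rule: generate.induct)
    case one then show ?case using x0_carrier by simp
  next
    case (incl h) then show ?case using step by blast
  next
    case (inv h)
    then have "h \<in> carrier thompson_F" using sub by blast
    then show ?case using step[OF inv] F.conj_inv[OF x0_carrier] by simp
  next
    case (eng h1 h2)
    then have "h1 \<in> carrier thompson_F" "h2 \<in> carrier thompson_F"
      using F.generate_incl[OF sub] by auto
    then show ?case using eng F.conj_mult[OF x0_carrier] by simp
  qed
qed

lemma bump_in_base: "bump \<in> base_group"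
proof -
  have "bump \<in> range (\<lambda>i::int. x0 [^]\<^bsub>thompson_F\<^esub> i \<otimes>\<^bsub>thompson_F\<^esub> bump \<otimes>\<^bsub>thompson_F\<^esub> inv\<^bsub>thompson_F\<^esub> (x0 [^]\<^bsub>thompson_F\<^esub> i))"
    by (rule range_eqI[of _ _ 0]) (simp add: bump_carrier)
  then show ?thesis unfolding base_group_def by (rule generate.incl)
qed

text \<open>
  The exponent function of \<open>h\<close> is known, and the functional takes the absolute value \<open>n ^ m\<close> on it; a word
  in \<open>X\<close> has at least as many letters.
\<close>

lemma word_length_lower_bound:
  fixes m n :: nat
  defines "X \<equiv> {x0, (conj_diff thompson_F x0 1 ^^ m) bump}"
    and "h \<equiv> (conj_diff thompson_F x0 n ^^ m) bump"
  shows "n ^ m \<le> word_length thompson_F X h"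
proof -
  have hX: "h \<in> generate thompson_F X"
    unfolding h_def X_def by (rule base.conj_diff_funpow_generate[OF bump_in_base])
  have "X \<subseteq> carrier thompson_F"
    using base.conj_diff_funpow_N[OF bump_in_base] x0_carrier unfolding X_def by simp
  then obtain ws where ws: "length ws = word_length thompson_F X h"
    "set ws \<subseteq> X \<union> m_inv thompson_F ` X" "foldr (mult thompson_F) ws \<one>\<^bsub>thompson_F\<^esub> = h"
    using F.word_length_word[OF _ hX] by blast
  obtain e g where g: "acts h e g" "\<And>s. \<bar>pairing g (\<lambda>i. of_int (i + s) gchoose m)\<bar> \<le> real (length ws)"
    using word_acts[of ws m] ws unfolding X_def by auto
  have "g = (diff_op n ^^ m) unit_fun"
    using acts_unique[OF g(1)] acts_conj_diff_funpow[of m n] unfolding h_def by blast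
  then have "\<bar>(- real n) ^ m\<bar> \<le> real (length ws)"
    using g(2)[of 0] pairing_diff_op_gbinomial[where n = n and m = m and s = 0] by simp
  then have "real (n ^ m) \<le> real (length ws)" by (simp add: power_abs)
  then show ?thesis using ws by simp
qed

theorem theorem38:
  fixes d :: nat
  assumes "d \<ge> 2"
  shows "\<exists>(K :: (real \<Rightarrow> real) set) (X :: (real \<Rightarrow> real) set) (Y :: (real \<Rightarrow> real) set) (C :: nat).
    subgroup K thompson_F \<and>
    finite X \<and> X \<subseteq> K \<and> generate thompson_F X = K \<and>
    finite Y \<and> Y \<subseteq> carrier thompson_F \<and> generate thompson_F Y = carrier thompson_F \<and>
    C > 0 \<and> (\<forall>n::nat. n > 0 \<longrightarrow> n ^ d \<le> C * distortion thompson_F K X Y n)"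
proof -
  define b where "b = (conj_diff thompson_F x0 1 ^^ d) bump"
  define X where "X = {x0, b}"
  define K where "K = generate thompson_F X"
  define Y where "Y = {x0, rscale x0, bump}"
  \<comment> \<open>It bounds \<open>2 ^ d * (2 * j + 1) / j\<close> for \<open>j \<ge> 1\<close>, where the numerator bounds the length of \<open>h j\<close>.\<close>
  define c :: nat where "c = 3 * 2 ^ d"
  define h where "h j = (conj_diff thompson_F x0 j ^^ d) bump" for j
  have X: "X \<subseteq> carrier thompson_F"
    using base.conj_diff_funpow_N[OF bump_in_base] x0_carrier unfolding X_def b_def by simp
  have Y: "Y \<subseteq> carrier thompson_F"
    unfolding Y_def using x0_carrier bump_carrier rscale_carrier by simp
  have K: "subgroup K thompson_F" unfolding K_def by (rule F.generate_is_subgroup[OF X])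
  have XK: "X \<subseteq> K" unfolding K_def by (auto intro: generate.incl)
  have x0K: "x0 \<in> K" using XK unfolding X_def by simp
  have genY: "generate thompson_F Y = carrier thompson_F"
  proof (rule equalityI[OF F.generate_incl[OF Y]])
    show "carrier thompson_F \<subseteq> generate thompson_F Y"
      using thompson_F_generated F.mono_generate[of "{x0, rscale x0}" Y] unfolding Y_def by auto
  qed
  have finY: "finite Y" unfolding Y_def by simp
  note disto = F.word_length_le_distortion[OF finY Y genY subgroup.subset[OF K], where X = X]
  have bound: "n ^ d \<le> (2 * c) ^ d * distortion thompson_F K X Y n" if n: "n > 0" for n
  proof (cases "n < c")
    case True
    \<comment> \<open>For small \<open>n\<close> it is enough that the distortion is positive, and \<open>x0\<close> is a witness.\<close>
    have "word_length thompson_F Y x0 \<le> n"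
      using F.word_length_generator[of x0 Y] Y n unfolding Y_def by simp
    then have "word_length thompson_F X x0 \<le> distortion thompson_F K X Y n"
      using x0K by (intro disto)
    moreover have "word_length thompson_F X x0 \<noteq> 0"
    proof
      assume 0: "word_length thompson_F X x0 = 0"
      have "x0 \<in> generate thompson_F X" unfolding X_def by (auto intro: generate.incl)
      then obtain ws where "length ws = word_length thompson_F X x0"
        "foldr (mult thompson_F) ws \<one>\<^bsub>thompson_F\<^esub> = x0"
        using F.word_length_word[OF X] by blast
      then have "x0 = \<one>\<^bsub>thompson_F\<^esub>" using 0 by simp
      moreover have "\<one>\<^bsub>thompson_F\<^esub> (1/4 :: real) = 1/4" by (simp add: F_one_apply)
      moreover have "x0 (1/4) = 1/2" by (simp add: x0_def)
      ultimately show False by simp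
    qed
    ultimately have "1 \<le> distortion thompson_F K X Y n" by linarith
    moreover have "n ^ d \<le> (2 * c) ^ d" using True by (intro power_mono) auto
    ultimately show ?thesis using mult_le_mono[of "n ^ d" "(2 * c) ^ d" 1] by simp
  next
    case False
    \<comment> \<open>The length of \<open>h j\<close> in \<open>Y\<close> is at most \<open>c * j\<close>; this is the largest \<open>j\<close> for which it is known to be at most \<open>n\<close>.\<close>
    define j where "j = n div c"
    have c: "c > 0" unfolding c_def by simp
    have j: "j \<ge> 1" using False c unfolding j_def by (simp add: div_greater_zero_iff Suc_leI)
    have jn: "c * j \<le> n" unfolding j_def by simp
    have "n < c * (j + 1)" using dividend_less_times_div[OF c, of n] by (simp add: j_def)
    also have "\<dots> \<le> 2 * c * j" using j by simp
    finally have nj: "n \<le> 2 * c * j" by simp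
    have "word_length thompson_F Y (h j) \<le> 2 ^ d * (2 * j + 1)"
      unfolding h_def using F.word_length_conj_diff_funpow[OF Y] unfolding Y_def by simp
    also have "\<dots> \<le> 2 ^ d * (3 * j)" using j by (intro mult_le_mono) auto
    also have "\<dots> \<le> n" using jn unfolding c_def by (simp add: algebra_simps)
    finally have "word_length thompson_F Y (h j) \<le> n" .
    moreover have "h j \<in> K"
      unfolding h_def K_def X_def b_def by (rule base.conj_diff_funpow_generate[OF bump_in_base])
    ultimately have "word_length thompson_F X (h j) \<le> distortion thompson_F K X Y n"
      by (intro disto)
    moreover have "j ^ d \<le> word_length thompson_F X (h j)"
      unfolding h_def X_def b_def by (rule word_length_lower_bound)
    ultimately have jd: "j ^ d \<le> distortion thompson_F K X Y n" by simp
    have "n ^ d \<le> (2 * c * j) ^ d" using nj by (intro power_mono) auto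
    also have "\<dots> = (2 * c) ^ d * j ^ d" by (simp add: power_mult_distrib)
    also have "\<dots> \<le> (2 * c) ^ d * distortion thompson_F K X Y n" using jd by simp
    finally show ?thesis .
  qed
  have "(2 * c) ^ d > 0" unfolding c_def by simp
  then show ?thesis
    using K XK Y genY finY bound
    by (intro exI[of _ K] exI[of _ X] exI[of _ Y] exI[of _ "(2 * c) ^ d"])
      (auto simp: K_def X_def)
qed

end
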